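(* There is a one-to-one correspondence between the following two sets: 1. admissible matrices, up to permutations of rows and of columns; 2. simply laced affine Dynkin diagrams together with a partition of the set of vertices into two subsets (a first, "black", and a second, "white", one) such that vertices in each subset are pairwise non-connected (up to isomorphism). Namely, given such a diagram, label the vertices of the first subset by $V_1,\dots,V_r$ and those of the second subset by $W_1,\dots,W_s$; the corresponding admissible $r\times s$ matrix $(a_{i,j})$ has $a_{i,j}$ equal to the number of edges between $V_i$ and $W_j$.
   Context: An $r\times s$ matrix $(a_{i,j})$ is decomposable if there exist partitions $\{1,\dots,r\}=I\sqcup I'$, $\{1,\dots,s\}=J\sqcup J'$ (non-trivial, i.e. $I\sqcup J$ and $I'\sqcup J'$ both non-empty) such that $a_{i,j}=0$ for $(i,j)\in (I\times J')\sqcup (I'\times J)$. An $r\times s$ matrix $(a_{i,j})$ with non-negative integer entries is admissible if it is indecomposable and there exist positive vectors $(m_1,\dots,m_r)$ and $(n_1,\dots,n_s)$ such that $$\sum_{j}a_{i,j}n_j=2m_i\ (1\le i\le r),\qquad \sum_ia_{i,j}m_i=2n_j\ (1\le j\le s).$$ Simply laced affine Dynkin diagrams are those of types $\tilde A_l$ ($l\ge1$), $\tilde D_l$ ($l\ge4$), $\tilde E_6,\tilde E_7,\tilde E_8$; here $\tilde A_1$ is included, with two vertices joined by two edges. *)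

theory Defs
  imports "Jordan_Normal_Form.Matrix" "HOL-Library.Multiset" "HOL-Combinatorics.Permutations"
begin

text \<open>Rows and columns are numbered from 0, as usual for the type of matrices used here.\<close>

definition decomposable :: "nat mat \<Rightarrow> bool" where
  "decomposable A \<longleftrightarrow> (\<exists>I I' J J'.
     I \<union> I' = {..<dim_row A} \<and> I \<inter> I' = {} \<and>
     J \<union> J' = {..<dim_col A} \<and> J \<inter> J' = {} \<and>
     (I \<noteq> {} \<or> J \<noteq> {}) \<and> (I' \<noteq> {} \<or> J' \<noteq> {}) \<and>
     (\<forall>(i, j) \<in> I \<times> J' \<union> I' \<times> J. A $$ (i, j) = 0))"

text \<open>The dimensions are required to be positive; this only excludes the empty 0 by 0 matrix,
  for which all the other conditions are vacuous.\<close>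

definition admissible :: "nat mat \<Rightarrow> bool" where
  "admissible A \<longleftrightarrow> 1 \<le> dim_row A \<and> 1 \<le> dim_col A \<and> \<not> decomposable A \<and>
     (\<exists>(m :: nat \<Rightarrow> real) (n :: nat \<Rightarrow> real).
        (\<forall>i<dim_row A. 0 < m i) \<and> (\<forall>j<dim_col A. 0 < n j) \<and>
        (\<forall>i<dim_row A. (\<Sum>j<dim_col A. real (A $$ (i, j)) * n j) = 2 * m i) \<and>
        (\<forall>j<dim_col A. (\<Sum>i<dim_row A. real (A $$ (i, j)) * m i) = 2 * n j))"

definition perm_equiv :: "nat mat rel" where
  "perm_equiv = {(A, B). admissible A \<and> admissible B \<and>
     (\<exists>p q. p permutes {..<dim_row A} \<and> q permutes {..<dim_col A} \<and>
        B = mat (dim_row A) (dim_col A) (\<lambda>(i, j). A $$ (p i, q j)))}"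

text \<open>Undirected multigraphs: an edge is given by the set of its end points, and the number of edges
  between \<open>u\<close> and \<open>v\<close> is the multiplicity of \<open>{u, v}\<close>.\<close>

datatype 'v multigraph = Multigraph (verts: "'v set") (edges: "'v set multiset")

definition edge_count :: "'v multigraph \<Rightarrow> 'v \<Rightarrow> 'v \<Rightarrow> nat" where
  "edge_count G u v = count (edges G) {u, v}"

definition graph_iso :: "('v \<Rightarrow> 'w) \<Rightarrow> 'v multigraph \<Rightarrow> 'w multigraph \<Rightarrow> bool" where
  "graph_iso f G H \<longleftrightarrow> bij_betw f (verts G) (verts H) \<and> image_mset ((`) f) (edges G) = edges H"

text \<open>For \<open>l = 1\<close> this has the two vertices 0 and 1, joined by two edges.\<close>

definition affine_A :: "nat \<Rightarrow> nat multigraph" where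
  "affine_A l = Multigraph {0..l} (image_mset (\<lambda>k. {k, (k + 1) mod (l + 1)}) (mset_set {0..l}))"

text \<open>The vertices of the diagrams of types D and E are numbered as in Bourbaki, with 0 the
  additional vertex of the affine diagram.\<close>

definition affine_D :: "nat \<Rightarrow> nat multigraph" where
  "affine_D l = Multigraph {0..l}
     ({#{0, 2}#} + image_mset (\<lambda>k. {k, k + 1}) (mset_set {1..l - 2}) + {#{l - 2, l}#})"

definition affine_E6 :: "nat multigraph" where
  "affine_E6 = Multigraph {0..6} {#{1, 3}, {3, 4}, {4, 5}, {5, 6}, {4, 2}, {2, 0}#}"

definition affine_E7 :: "nat multigraph" where
  "affine_E7 = Multigraph {0..7} {#{0, 1}, {1, 3}, {3, 4}, {4, 5}, {5, 6}, {6, 7}, {4, 2}#}"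

definition affine_E8 :: "nat multigraph" where
  "affine_E8 = Multigraph {0..8} {#{1, 3}, {3, 4}, {4, 5}, {5, 6}, {6, 7}, {7, 8}, {8, 0}, {4, 2}#}"

definition simply_laced_affine_dynkin :: "'v multigraph \<Rightarrow> bool" where
  "simply_laced_affine_dynkin G \<longleftrightarrow>
     (\<exists>H f. (H \<in> affine_A ` {1..} \<union> affine_D ` {4..} \<union> {affine_E6, affine_E7, affine_E8}) \<and>
            graph_iso f H G)"

text \<open>A triple consists of a diagram, its set of black vertices and its set of white vertices.\<close>

type_synonym 'v bicolored = "'v multigraph \<times> 'v set \<times> 'v set"

definition bicolored_affine_diagrams :: "'v bicolored set" where
  "bicolored_affine_diagrams = {(G, B, W). simply_laced_affine_dynkin G \<and>
     B \<union> W = verts G \<and> B \<inter> W = {} \<and>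
     (\<forall>u\<in>B. \<forall>v\<in>B. edge_count G u v = 0) \<and> (\<forall>u\<in>W. \<forall>v\<in>W. edge_count G u v = 0)}"

definition diagram_iso :: "'v bicolored rel" where
  "diagram_iso = {((G, B, W), (G', B', W')).
     (G, B, W) \<in> bicolored_affine_diagrams \<and> (G', B', W') \<in> bicolored_affine_diagrams \<and>
     (\<exists>f. graph_iso f G G' \<and> f ` B = B' \<and> f ` W = W')}"

definition diagram_matrix ::
    "'v multigraph \<Rightarrow> nat \<Rightarrow> nat \<Rightarrow> (nat \<Rightarrow> 'v) \<Rightarrow> (nat \<Rightarrow> 'v) \<Rightarrow> nat mat" where
  "diagram_matrix G r s V W = mat r s (\<lambda>(i, j). edge_count G (V i) (W j))"

lemma equiv_perm_equiv: "equiv {A. admissible A} perm_equiv"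
proof (rule equivI)
  show "perm_equiv \<subseteq> {A. admissible A} \<times> {A. admissible A}"
    by (auto simp: perm_equiv_def)
  show "refl_on {A. admissible A} perm_equiv"
  proof (rule refl_onI)
    fix A :: "nat mat" assume "A \<in> {A. admissible A}"
    moreover have "A = mat (dim_row A) (dim_col A) (\<lambda>(i, j). A $$ (id i, id j))"
      by (rule eq_matI) auto
    ultimately show "(A, A) \<in> perm_equiv"
      unfolding perm_equiv_def using permutes_id by blast
  qed
  show "sym perm_equiv"
  proof (rule symI)
    fix A B assume "(A, B) \<in> perm_equiv"
    then obtain p q where ad: "admissible A" "admissible B"
      and p: "p permutes {..<dim_row A}" and q: "q permutes {..<dim_col A}"
      and B: "B = mat (dim_row A) (dim_col A) (\<lambda>(i, j). A $$ (p i, q j))"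
      unfolding perm_equiv_def by blast
    have "A = mat (dim_row B) (dim_col B) (\<lambda>(i, j). B $$ (inv_into UNIV p i, inv_into UNIV q j))"
      using permutes_in_image[OF permutes_inv[OF p]] permutes_in_image[OF permutes_inv[OF q]]
      by (intro eq_matI) (auto simp: B permutes_inverses[OF p] permutes_inverses[OF q])
    moreover have "dim_row B = dim_row A" "dim_col B = dim_col A"
      by (simp_all add: B)
    ultimately show "(B, A) \<in> perm_equiv"
      using ad permutes_inv[OF p] permutes_inv[OF q] unfolding perm_equiv_def mem_Collect_eq case_prod_conv
      by metis
  qed
  show "trans perm_equiv"
  proof (rule transI)
    fix A B C assume "(A, B) \<in> perm_equiv" "(B, C) \<in> perm_equiv"
    then obtain p q p' q' where ad: "admissible A" "admissible C"
      and p: "p permutes {..<dim_row A}" and q: "q permutes {..<dim_col A}"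
      and B: "B = mat (dim_row A) (dim_col A) (\<lambda>(i, j). A $$ (p i, q j))"
      and p': "p' permutes {..<dim_row B}" and q': "q' permutes {..<dim_col B}"
      and C: "C = mat (dim_row B) (dim_col B) (\<lambda>(i, j). B $$ (p' i, q' j))"
      unfolding perm_equiv_def by blast
    have p'': "p' permutes {..<dim_row A}" and q'': "q' permutes {..<dim_col A}"
      using p' q' by (simp_all add: B)
    have "C = mat (dim_row A) (dim_col A) (\<lambda>(i, j). A $$ ((p \<circ> p') i, (q \<circ> q') j))"
      using permutes_in_image[OF p''] permutes_in_image[OF q'']
      by (intro eq_matI) (auto simp: C B)
    with ad permutes_compose[OF p'' p] permutes_compose[OF q'' q] show "(A, C) \<in> perm_equiv"
      unfolding perm_equiv_def mem_Collect_eq case_prod_conv by metis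
  qed
qed

lemma affine_edges_subset:
  assumes "simply_laced_affine_dynkin G" "e \<in># edges G"
  shows "e \<subseteq> verts G"
proof -
  obtain H f where H: "H \<in> affine_A ` {1..} \<union> affine_D ` {4..} \<union> {affine_E6, affine_E7, affine_E8}"
    and f: "graph_iso f H G"
    using assms(1) unfolding simply_laced_affine_dynkin_def by blast
  have H_edges: "d \<subseteq> verts H" if "d \<in># edges H" for d
    using H that
  proof (elim UnE)
    assume "H \<in> affine_A ` {1..}"
    then show ?thesis using that by (auto simp: affine_A_def mod_Suc_le_divisor)
  next
    assume "H \<in> affine_D ` {4..}"
    then obtain l where "4 \<le> l" "H = affine_D l" by auto
    then show ?thesis using that by (auto simp: affine_D_def)
  next
    assume "H \<in> {affine_E6, affine_E7, affine_E8}"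
    then show ?thesis using that by (auto simp: affine_E6_def affine_E7_def affine_E8_def)
  qed
  obtain d where d: "d \<in># edges H" "e = f ` d"
    using f assms(2) unfolding graph_iso_def by (metis image_iff set_image_mset)
  have "f ` d \<subseteq> f ` verts H" using H_edges[OF d(1)] by (rule image_mono)
  then show ?thesis using f d(2) by (simp add: graph_iso_def bij_betw_def)
qed

lemma equiv_diagram_iso:
  "equiv (bicolored_affine_diagrams :: 'v bicolored set) diagram_iso"
proof (rule equivI)
  show "diagram_iso \<subseteq> (bicolored_affine_diagrams :: 'v bicolored set) \<times> bicolored_affine_diagrams"
    by (auto simp: diagram_iso_def)
  show "refl_on (bicolored_affine_diagrams :: 'v bicolored set) diagram_iso"
  proof (rule refl_onI)
    fix D :: "'v bicolored" assume D: "D \<in> bicolored_affine_diagrams"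
    obtain G B W where "D = (G, B, W)" by (cases D)
    moreover have "graph_iso id G G" by (simp add: graph_iso_def)
    ultimately show "(D, D) \<in> diagram_iso"
      using D by (auto simp: diagram_iso_def intro!: exI[of _ id])
  qed
  show "sym (diagram_iso :: 'v bicolored rel)"
  proof (rule symI)
    fix D D' :: "'v bicolored" assume DD: "(D, D') \<in> diagram_iso"
    obtain G B W G' B' W' f where D: "D = (G, B, W)" "D' = (G', B', W')"
      and mem: "D \<in> bicolored_affine_diagrams" "D' \<in> bicolored_affine_diagrams"
      and f: "bij_betw f (verts G) (verts G')" "image_mset ((`) f) (edges G) = edges G'"
        "f ` B = B'" "f ` W = W'"
      using DD unfolding diagram_iso_def graph_iso_def by blast
    let ?g = "inv_into (verts G) f"
    have inv: "?g ` f ` X = X" if "X \<subseteq> verts G" for X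
      using that f(1) by (meson bij_betw_def inv_into_image_cancel)
    have ed: "e \<subseteq> verts G" if "e \<in># edges G" for e
      using that mem(1) affine_edges_subset D unfolding bicolored_affine_diagrams_def by blast
    have "image_mset ((`) ?g) (edges G') = image_mset (\<lambda>e. ?g ` f ` e) (edges G)"
      by (simp add: f(2)[symmetric] multiset.map_comp comp_def)
    also have "\<dots> = image_mset (\<lambda>e. e) (edges G)"
      by (rule image_mset_cong) (simp add: inv ed)
    finally have "graph_iso ?g G' G"
      using bij_betw_inv_into[OF f(1)] by (simp add: graph_iso_def)
    moreover have "B \<subseteq> verts G" "W \<subseteq> verts G"
      using mem(1) D unfolding bicolored_affine_diagrams_def by auto
    then have "?g ` B' = B" "?g ` W' = W"
      unfolding f(3,4)[symmetric] by (simp_all only: inv)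
    ultimately show "(D', D) \<in> diagram_iso"
      using mem D unfolding diagram_iso_def by blast
  qed
  show "trans (diagram_iso :: 'v bicolored rel)"
  proof (rule transI)
    fix D D' D'' :: "'v bicolored"
    assume a: "(D, D') \<in> diagram_iso" "(D', D'') \<in> diagram_iso"
    obtain G B W G' B' W' f where D: "D = (G, B, W)" "D' = (G', B', W')"
      and mem: "D \<in> bicolored_affine_diagrams"
      and f: "graph_iso f G G'" "f ` B = B'" "f ` W = W'"
      using a(1) unfolding diagram_iso_def by blast
    obtain G'' B'' W'' g where D': "D'' = (G'', B'', W'')"
      and mem': "D'' \<in> bicolored_affine_diagrams"
      and g: "graph_iso g G' G''" "g ` B' = B''" "g ` W' = W''"
      using a(2) D unfolding diagram_iso_def by blast
    have "graph_iso (g \<circ> f) G G''"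
    proof -
      have "image_mset ((`) (g \<circ> f)) (edges G) = image_mset ((`) g) (image_mset ((`) f) (edges G))"
        by (simp add: multiset.map_comp comp_def image_image)
      then show ?thesis
        using f(1) g(1) bij_betw_trans unfolding graph_iso_def by auto
    qed
    moreover have "(g \<circ> f) ` B = B''" "(g \<circ> f) ` W = W''"
      using f g by (auto simp: image_comp)
    ultimately show "(D, D'') \<in> diagram_iso"
      using mem mem' D D' unfolding diagram_iso_def by blast
  qed
qed

end

theory Submission
  imports Defs
begin

text \<open>An admissible matrix is the adjacency matrix of a connected bipartite multigraph together with
  a positive labelling \<open>x\<close> for which the sum over the neighbours of each vertex is twice its label.
  Every affine diagram carries such a labelling. Conversely, if a graph \<open>G\<close> with such a labelling
  contains an affine diagram \<open>H\<close> as a subgraph, then pairing the two labellings forces \<open>H = G\<close>, so it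
  suffices to find an affine diagram inside \<open>G\<close>. A multiple edge or a cycle gives type A, a vertex of
  degree at least 4 or two vertices of degree 3 give type D. Otherwise \<open>G\<close> has a vertex of degree 3
  and each of its three arms ends in a leaf; the labels along an arm with \<open>n\<close> edges are proportional
  to \<open>n + 1, n, \<dots>, 1\<close>, so the three lengths satisfy \<open>\<Sum> n/(n + 1) = 2\<close>, which leaves only the
  types E. (If there is no vertex of degree 3, the same arithmetic progressions give a
  contradiction.)\<close>

section \<open>Graphs with a positive harmonic labelling\<close>

lemma count_image_mset_image:
  assumes "inj_on f X" "\<forall>d\<in>#M. d \<subseteq> X" "e \<subseteq> X"
  shows "count (image_mset ((`) f) M) (f ` e) = count M e"
  using assms(2) by (induction M) (auto simp: inj_on_image_eq_iff[OF assms(1)] assms(3))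

lemma graph_iso_edge_count:
  assumes "graph_iso f G H" "\<forall>e\<in>#edges G. e \<subseteq> verts G" "u \<in> verts G" "v \<in> verts G"
  shows "edge_count H (f u) (f v) = edge_count G u v"
proof -
  have "inj_on f (verts G)" "edges H = image_mset ((`) f) (edges G)"
    using assms(1) by (auto simp: graph_iso_def bij_betw_def)
  with count_image_mset_image[of f "verts G" "edges G" "{u, v}"] assms show ?thesis
    by (simp add: edge_count_def)
qed

lemma edge_count_commute: "edge_count G u v = edge_count G v u"
  by (simp add: edge_count_def insert_commute)

locale affine_graph =
  fixes G :: "'v multigraph" and x :: "'v \<Rightarrow> real"
  assumes finite_verts: "finite (verts G)"
    and verts_nonempty: "verts G \<noteq> {}"
    and edge_subset: "e \<in># edges G \<Longrightarrow> e \<subseteq> verts G"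
    and card_edge: "e \<in># edges G \<Longrightarrow> card e = 2"
    and label_pos: "v \<in> verts G \<Longrightarrow> 0 < x v"
    and label_sum: "u \<in> verts G \<Longrightarrow> (\<Sum>v\<in>verts G. real (edge_count G u v) * x v) = 2 * x u"
    and connected: "\<lbrakk>S \<subseteq> verts G; S \<noteq> {}; \<And>e. e \<in># edges G \<Longrightarrow> e \<inter> S \<noteq> {} \<Longrightarrow> e \<subseteq> S\<rbrakk>
      \<Longrightarrow> S = verts G"

lemma affine_graph_iso:
  assumes "affine_graph G x" "graph_iso f G H"
  shows "affine_graph H (x \<circ> inv_into (verts G) f)"
proof -
  interpret affine_graph G x by fact
  let ?g = "inv_into (verts G) f"
  have inj: "inj_on f (verts G)" and vH: "verts H = f ` verts G"
    and eH: "edges H = image_mset ((`) f) (edges G)"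
    using assms(2) by (auto simp: graph_iso_def bij_betw_def)
  note ec = graph_iso_edge_count[OF assms(2)]
  show ?thesis
  proof
    show "finite (verts H)" "verts H \<noteq> {}"
      using finite_verts verts_nonempty by (auto simp: vH)
    show "e \<subseteq> verts H" if "e \<in># edges H" for e
      using that edge_subset by (auto simp: eH vH)
    show "card e = 2" if e: "e \<in># edges H" for e
    proof -
      obtain d where d: "d \<in># edges G" "e = f ` d" using e by (auto simp: eH)
      show ?thesis using card_image[OF inj_on_subset[OF inj edge_subset[OF d(1)]]] card_edge[OF d(1)] d(2)
        by simp
    qed
    show "0 < (x \<circ> ?g) v" if "v \<in> verts H" for v
      using that label_pos by (auto simp: vH inj)
    show "(\<Sum>v\<in>verts H. real (edge_count H u v) * (x \<circ> ?g) v) = 2 * (x \<circ> ?g) u"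
      if u: "u \<in> verts H" for u
    proof -
      obtain u' where u': "u' \<in> verts G" "u = f u'" using u by (auto simp: vH)
      have "(\<Sum>v\<in>verts H. real (edge_count H u v) * (x \<circ> ?g) v) =
          (\<Sum>v\<in>verts G. real (edge_count H u (f v)) * (x \<circ> ?g) (f v))"
        by (simp add: vH sum.reindex[OF inj])
      also have "\<dots> = (\<Sum>v\<in>verts G. real (edge_count G u' v) * x v)"
        using u' edge_subset by (intro sum.cong) (auto simp: ec inj)
      finally show ?thesis using label_sum[OF u'(1)] u' inj by simp
    qed
    show "S = verts H"
      if S: "S \<subseteq> verts H" "S \<noteq> {}" "\<And>e. e \<in># edges H \<Longrightarrow> e \<inter> S \<noteq> {} \<Longrightarrow> e \<subseteq> S" for S
    proof -
      let ?T = "{v \<in> verts G. f v \<in> S}"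
      have "?T = verts G"
      proof (rule connected)
        show "?T \<subseteq> verts G" by blast
        show "?T \<noteq> {}" using S(1,2) by (auto simp: vH)
        fix e assume e: "e \<in># edges G" "e \<inter> ?T \<noteq> {}"
        have "f ` e \<subseteq> S" using e by (intro S(3)) (auto simp: eH)
        then show "e \<subseteq> ?T" using edge_subset[OF e(1)] by auto
      qed
      then show ?thesis using S(1) by (auto simp: vH)
    qed
  qed
qed

context affine_graph
begin

lemma edge_pairE:
  assumes "e \<in># edges G"
  obtains u v where "e = {u, v}" "u \<noteq> v" "u \<in> verts G" "v \<in> verts G"
  using card_edge[OF assms] edge_subset[OF assms] by (auto simp: card_2_iff)

lemma not_loop: "\<not> {u} \<in># edges G"
  using card_edge[of "{u}"] by auto

end

text \<open>Pairing the two labellings with each other shows that \<open>G\<close> has no edges at the vertices of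
  \<open>H\<close> apart from those of \<open>H\<close>; connectedness does the rest.\<close>

lemma affine_subgraph_eq:
  assumes "affine_graph G x" "affine_graph H y" "verts H \<subseteq> verts G" "edges H \<subseteq># edges G"
  shows "H = G"
proof -
  interpret G: affine_graph G x by fact
  interpret H: affine_graph H y by fact
  have le: "edge_count H u v \<le> edge_count G u v" for u v
    using assms(4) by (simp add: edge_count_def mset_subset_eq_count)
  have out: "edge_count H u v = 0" if "v \<notin> verts H" for u v
    using that H.edge_subset[of "{u, v}"] by (auto simp: edge_count_def count_eq_zero_iff)
  let ?d = "\<lambda>u v. (real (edge_count G u v) - real (edge_count H u v)) * y u * x v"
  have Hsum: "(\<Sum>v\<in>verts G. real (edge_count H u v) * z v) = (\<Sum>v\<in>verts H. real (edge_count H u v) * z v)" for u z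
    using assms(3) G.finite_verts out by (intro sum.mono_neutral_right) auto
  have "(\<Sum>u\<in>verts H. \<Sum>v\<in>verts G. ?d u v) =
      (\<Sum>u\<in>verts H. y u * (\<Sum>v\<in>verts G. real (edge_count G u v) * x v)) -
      (\<Sum>u\<in>verts H. y u * (\<Sum>v\<in>verts G. real (edge_count H u v) * x v))"
    by (simp add: sum_subtractf[symmetric] sum_distrib_left algebra_simps)
  also have "(\<Sum>u\<in>verts H. y u * (\<Sum>v\<in>verts G. real (edge_count G u v) * x v)) = (\<Sum>u\<in>verts H. y u * (2 * x u))"
    using assms(3) by (intro sum.cong refl) (auto simp: G.label_sum)
  also have "(\<Sum>u\<in>verts H. y u * (\<Sum>v\<in>verts G. real (edge_count H u v) * x v)) =
      (\<Sum>u\<in>verts H. \<Sum>v\<in>verts H. real (edge_count H v u) * y u * x v)"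
    unfolding Hsum by (simp add: sum_distrib_left mult_ac edge_count_commute)
  also have "\<dots> = (\<Sum>v\<in>verts H. x v * (\<Sum>u\<in>verts H. real (edge_count H v u) * y u))"
    by (subst sum.swap) (simp add: sum_distrib_left algebra_simps)
  also have "\<dots> = (\<Sum>v\<in>verts H. x v * (2 * y v))"
    by (intro sum.cong refl) (auto simp: H.label_sum)
  finally have zero: "(\<Sum>u\<in>verts H. \<Sum>v\<in>verts G. ?d u v) = 0"
    by (simp add: algebra_simps)
  have nonneg: "0 \<le> ?d u v" if "u \<in> verts H" "v \<in> verts G" for u v
    using le[of u v] H.label_pos[OF that(1)] G.label_pos[OF that(2)] by simp
  have eq: "edge_count G u v = edge_count H u v" if uv: "u \<in> verts H" "v \<in> verts G" for u v
  proof -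
    have "(\<Sum>v\<in>verts G. ?d u v) = 0"
      using zero uv(1) H.finite_verts nonneg by (subst (asm) sum_nonneg_eq_0_iff) (auto intro: sum_nonneg)
    then have "?d u v = 0"
      using uv G.finite_verts nonneg by (subst (asm) sum_nonneg_eq_0_iff) auto
    then show ?thesis using H.label_pos[OF uv(1)] G.label_pos[OF uv(2)] by simp
  qed
  have verts: "verts H = verts G"
  proof (rule G.connected)
    fix e assume e: "e \<in># edges G" "e \<inter> verts H \<noteq> {}"
    from e(2) obtain u where u: "u \<in> e" "u \<in> verts H" by blast
    then obtain v where v: "e = {u, v}" "v \<in> verts G"
      using G.edge_pairE[OF e(1)] by (metis insertE insert_commute singletonD)
    then have "edge_count H u v \<noteq> 0" using eq[OF u(2) v(2)] e(1) by (metis count_eq_zero_iff edge_count_def)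
    then show "e \<subseteq> verts H" using out[of v u] u v by auto
  qed (use assms(3) H.verts_nonempty in auto)
  have "edges H = edges G"
  proof (rule multiset_eqI)
    fix e
    show "count (edges H) e = count (edges G) e"
    proof (cases "e \<in># edges G")
      case True
      then show ?thesis using eq G.edge_pairE[OF True] verts by (metis edge_count_def)
    next
      case False
      then show ?thesis using assms(4) by (metis count_eq_zero_iff mset_subset_eqD)
    qed
  qed
  with verts show ?thesis by (simp add: multigraph.expand)
qed

lemma affine_graph_embedding:
  assumes "affine_graph G x" "affine_graph H y" "inj_on f (verts H)" "f ` verts H \<subseteq> verts G"
    "image_mset ((`) f) (edges H) \<subseteq># edges G"
  shows "graph_iso f H G"
proof -
  let ?H = "Multigraph (f ` verts H) (image_mset ((`) f) (edges H))"
  have iso: "graph_iso f H ?H"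
    using assms(3) by (simp add: graph_iso_def bij_betw_def)
  have "?H = G"
    using affine_subgraph_eq[OF assms(1) affine_graph_iso[OF assms(2) iso]] assms(4,5) by simp
  with iso show ?thesis by simp
qed

section \<open>The affine diagrams\<close>

lemma sum_edge_count:
  fixes x :: "'v \<Rightarrow> real"
  assumes "finite X" "\<forall>e\<in>#M. e \<subseteq> X \<and> card e = 2"
  shows "(\<Sum>v\<in>X. real (count M {u, v}) * x v) = (\<Sum>e\<in>#M. if u \<in> e then sum x (e - {u}) else 0)"
  using assms(2)
proof (induction M)
  case (add e M)
  have e: "e \<subseteq> X" "card e = 2" using add.prems by auto
  have "(\<Sum>v\<in>X. (if {u, v} = e then x v else 0)) = (if u \<in> e then sum x (e - {u}) else 0)"
  proof (cases "u \<in> e")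
    case True
    then obtain w where w: "e = {u, w}" "u \<noteq> w" using e(2) by (auto simp: card_2_iff)
    then have "({u, v} = e) = (v = w)" for v by (auto simp: doubleton_eq_iff)
    moreover have "e - {u} = {w}" using w by auto
    ultimately show ?thesis using w e(1) assms(1) by simp
  next
    case False
    then show ?thesis by (auto intro: sum.neutral)
  qed
  moreover have "(\<Sum>v\<in>X. real (count (add_mset e M) {u, v}) * x v) =
     (\<Sum>v\<in>X. (if {u, v} = e then x v else 0)) + (\<Sum>v\<in>X. real (count M {u, v}) * x v)"
    unfolding sum.distrib[symmetric] by (intro sum.cong refl) (auto simp: algebra_simps)
  ultimately show ?case using add by simp
qed simp

lemma sum_remove_pair:
  fixes x :: "'v \<Rightarrow> real"
  assumes "a \<noteq> b"
  shows "(if u \<in> {a, b} then sum x ({a, b} - {u}) else 0) =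
    (if u = a then x b else 0) + (if u = b then x a else 0)"
  using assms by (auto simp: insert_Diff_if)

lemma affine_graphI:
  assumes "finite (verts G)" "verts G \<noteq> {}"
    and "\<And>e. e \<in># edges G \<Longrightarrow> e \<subseteq> verts G \<and> card e = 2"
    and "\<And>v. v \<in> verts G \<Longrightarrow> 0 < x v"
    and "\<And>u. u \<in> verts G \<Longrightarrow> (\<Sum>e\<in>#edges G. if u \<in> e then sum x (e - {u}) else 0) = 2 * x u"
    and "\<And>S u v. \<lbrakk>S \<subseteq> verts G; \<And>e. e \<in># edges G \<Longrightarrow> e \<subseteq> S \<or> e \<inter> S = {}; u \<in> S; v \<in> verts G\<rbrakk>
      \<Longrightarrow> v \<in> S"
  shows "affine_graph G x"
proof
  show "(\<Sum>v\<in>verts G. real (edge_count G u v) * x v) = 2 * x u" if "u \<in> verts G" for u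
    unfolding edge_count_def using assms(5)[OF that] assms(1,3) by (subst sum_edge_count) auto
  show "S = verts G"
    if "S \<subseteq> verts G" "S \<noteq> {}" "\<And>e. e \<in># edges G \<Longrightarrow> e \<inter> S \<noteq> {} \<Longrightarrow> e \<subseteq> S" for S
    using assms(6)[of S] that by blast
qed (use assms(1-4) in auto)

lemma affine_graph_A:
  assumes "1 \<le> l"
  shows "affine_graph (affine_A l) (\<lambda>_. 1)"
proof (rule affine_graphI)
  have ne: "k \<noteq> (k + 1) mod (l + 1)" if "k \<le> l" for k
    using that assms by (cases "k = l") auto
  show "e \<subseteq> verts (affine_A l) \<and> card e = 2" if "e \<in># edges (affine_A l)" for e
    using that ne by (force simp: affine_A_def)
  show "(\<Sum>e\<in>#edges (affine_A l). if u \<in> e then sum (\<lambda>_. 1) (e - {u}) else 0) = 2 * (1::real)"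
    if u: "u \<in> verts (affine_A l)" for u
  proof -
    have u': "u \<le> l" using u by (simp add: affine_A_def)
    have succ: "(u = (k + 1) mod (l + 1)) = (k = (if u = 0 then l else u - 1))" if "k \<le> l" for k
      using that u' by (cases "k = l") auto
    have "(\<Sum>e\<in>#edges (affine_A l). if u \<in> e then sum (\<lambda>_. 1) (e - {u}) else 0) =
       (\<Sum>k\<in>{0..l}. (if u \<in> {k, (k + 1) mod (l + 1)} then sum (\<lambda>_. 1) ({k, (k + 1) mod (l + 1)} - {u}) else 0))"
      by (simp only: affine_A_def multigraph.sel multiset.map_comp comp_def sum_unfold_sum_mset)
    also have "\<dots> = (\<Sum>k\<in>{0..l}. (if u = k then 1 else 0) + (if u = (k + 1) mod (l + 1) then 1 else (0::real)))"
      by (intro sum.cong refl sum_remove_pair ne) auto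
    also have "\<dots> = (\<Sum>k\<in>{0..l}. (if u = k then 1 else 0) + (if k = (if u = 0 then l else u - 1) then 1 else (0::real)))"
      by (intro sum.cong refl) (simp only: succ atLeastAtMost_iff)
    also have "\<dots> = 2" using u' by (auto simp: sum.distrib)
    finally show ?thesis by simp
  qed
  show "v \<in> S" if S: "S \<subseteq> verts (affine_A l)" "\<And>e. e \<in># edges (affine_A l) \<Longrightarrow> e \<subseteq> S \<or> e \<inter> S = {}"
      and u: "u \<in> S" and v: "v \<in> verts (affine_A l)" for S u v
  proof -
    have step: "(Suc k \<in> S) = (k \<in> S)" if "k < l" for k
    proof -
      have "{k, Suc k} \<in># edges (affine_A l)" using that by (auto simp: affine_A_def)
      from S(2)[OF this] show ?thesis by blast
    qed
    have all: "(k \<in> S) = (0 \<in> S)" if "k \<le> l" for k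
      using that by (induction k) (auto simp: step)
    have "u \<le> l" "v \<le> l" using S(1) u v by (auto simp: affine_A_def)
    then show ?thesis using all u by blast
  qed
  show "finite (verts (affine_A l))" "verts (affine_A l) \<noteq> {}" by (auto simp: affine_A_def)
qed simp

lemma affine_graph_D:
  assumes "4 \<le> l"
  shows "affine_graph (affine_D l) (\<lambda>k. if k \<in> {0, 1, l - 1, l} then 1 else 2)"
    (is "affine_graph _ ?y")
proof (rule affine_graphI)
  show "e \<subseteq> verts (affine_D l) \<and> card e = 2" if "e \<in># edges (affine_D l)" for e
    using that assms by (auto simp: affine_D_def)
  show "(\<Sum>e\<in>#edges (affine_D l). if u \<in> e then sum ?y (e - {u}) else 0) = 2 * ?y u"
    if u: "u \<in> verts (affine_D l)" for u
  proof -
    let ?s = "\<lambda>e. if u \<in> e then sum ?y (e - {u}) else 0"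
    have u': "u \<le> l" using u by (simp add: affine_D_def)
    have pred: "(u = k + 1) = (k = u - 1)" if "1 \<le> k" for k using that by auto
    have "(\<Sum>k\<in>{1..l - 2}. ?s {k, k + 1}) =
        (\<Sum>k\<in>{1..l - 2}. (if u = k then ?y (k + 1) else 0) + (if u = k + 1 then ?y k else 0))"
      by (intro sum.cong refl sum_remove_pair) auto
    also have "\<dots> = (\<Sum>k\<in>{1..l - 2}. (if u = k then ?y (k + 1) else 0) + (if k = u - 1 then ?y k else 0))"
      by (intro sum.cong refl) (simp only: pred atLeastAtMost_iff)
    also have "\<dots> = (if u \<in> {1..l-2} then ?y (u + 1) else 0) + (if u - 1 \<in> {1..l-2} then ?y (u - 1) else 0)"
      by (simp only: sum.distrib sum.delta sum.delta' finite_atLeastAtMost)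
    finally have path: "(\<Sum>k\<in>{1..l - 2}. ?s {k, k + 1}) = \<dots>" .
    have "(\<Sum>e\<in>#edges (affine_D l). ?s e) = ?s {0, 2} + (\<Sum>k\<in>{1..l - 2}. ?s {k, k + 1}) + ?s {l - 2, l}"
      by (simp only: affine_D_def multigraph.sel multiset.map_comp comp_def sum_unfold_sum_mset
          image_mset_union image_mset_single sum_mset.union sum_mset.singleton)
    also have "\<dots> = ((if u = 0 then ?y 2 else 0) + (if u = 2 then ?y 0 else 0)) + 
      ((if u \<in> {1..l-2} then ?y (u + 1) else 0) + (if u - 1 \<in> {1..l-2} then ?y (u - 1) else 0)) +
      ((if u = l - 2 then ?y l else 0) + (if u = l then ?y (l - 2) else 0))"
      unfolding path using assms by (subst (1 2) sum_remove_pair) auto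
    also have "\<dots> = 2 * ?y u"
    proof -
      obtain m where l: "l = m + 4" using assms by (metis le_add_diff_inverse2)
      consider "u = 0" | "u = 1" | "u = 2" "m = 0" | "u = 2" "0 < m" | "2 < u" "u < m + 2" | "u = m + 2" "0 < m" | "u = m + 3" | "u = m + 4"
        using u' l by linarith
      then show ?thesis unfolding l by cases auto
    qed
    finally show ?thesis .
  qed
  show "v \<in> S" if S: "S \<subseteq> verts (affine_D l)" "\<And>e. e \<in># edges (affine_D l) \<Longrightarrow> e \<subseteq> S \<or> e \<inter> S = {}"
      and u: "u \<in> S" and v: "v \<in> verts (affine_D l)" for S u v
  proof -
    have step: "(Suc k \<in> S) = (k \<in> S)" if "1 \<le> k" "k \<le> l - 2" for k
    proof -
      have "{k, Suc k} \<in># edges (affine_D l)" using that by (auto simp: affine_D_def)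
      from S(2)[OF this] show ?thesis by blast
    qed
    have path: "(k \<in> S) = (1 \<in> S)" if "1 \<le> k" "k \<le> l - 1" for k
      using that by (induction k rule: dec_induct) (auto simp: step)
    have "(0 \<in> S) = (2 \<in> S)" "(l \<in> S) = (l - 2 \<in> S)"
      using S(2)[of "{0, 2}"] S(2)[of "{l - 2, l}"] by (auto simp: affine_D_def)
    then have ends: "(0 \<in> S) = (1 \<in> S)" "(l \<in> S) = (1 \<in> S)"
      using path[of 2] path[of "l - 2"] assms by auto
    have all: "(k \<in> S) = (1 \<in> S)" if "k \<le> l" for k
      using path[of k] ends that by (cases "k = 0"; cases "k = l") auto
    have "u \<le> l" "v \<le> l" using S(1) u v by (auto simp: affine_D_def)
    then show ?thesis using all u by blast
  qed
  show "finite (verts (affine_D l))" "verts (affine_D l) \<noteq> {}" by (auto simp: affine_D_def)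
  show "0 < ?y v" for v by simp
qed

lemma affine_graph_E6:
  "affine_graph affine_E6 (\<lambda>k. [1, 1, 2, 2, 3, 2, 1] ! k)" (is "affine_graph _ ?y")
proof (rule affine_graphI)
  have v: "verts affine_E6 = {0, 1, 2, 3, 4, 5, 6}" by (auto simp: affine_E6_def)
  show "finite (verts affine_E6)" "verts affine_E6 \<noteq> {}" by (simp_all add: v)
  show "e \<subseteq> verts affine_E6 \<and> card e = 2" if "e \<in># edges affine_E6" for e
    using that by (auto simp: affine_E6_def)
  show "0 < ?y u" if "u \<in> verts affine_E6" for u
    using that by (auto simp: v)
  show "(\<Sum>e\<in>#edges affine_E6. if u \<in> e then sum ?y (e - {u}) else 0) = 2 * ?y u"
    if "u \<in> verts affine_E6" for u
    using that[unfolded v] unfolding affine_E6_def multigraph.sel image_mset_add_mset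
      sum_mset.insert image_mset_empty sum_mset.empty
    by (subst (1 2 3 4 5 6) sum_remove_pair) auto
  show "v \<in> S" if S: "\<And>e. e \<in># edges affine_E6 \<Longrightarrow> e \<subseteq> S \<or> e \<inter> S = {}"
    "u \<in> S" "v \<in> verts affine_E6" "S \<subseteq> verts affine_E6" for S u v
  proof -
    have "u \<in> verts affine_E6" using S(2,4) by blast
    moreover have "a \<in> S \<longleftrightarrow> b \<in> S" if "{a, b} \<in># edges affine_E6" for a b
      using S(1)[OF that] by blast
    note this[of 1 3] this[of 3 4] this[of 4 5] this[of 5 6] this[of 4 2] this[of 2 0]
    ultimately show ?thesis using S(2,3) unfolding v by (simp add: affine_E6_def) blast
  qed
qed

lemma affine_graph_E7:
  "affine_graph affine_E7 (\<lambda>k. [1, 2, 2, 3, 4, 3, 2, 1] ! k)" (is "affine_graph _ ?y")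
proof (rule affine_graphI)
  have v: "verts affine_E7 = {0, 1, 2, 3, 4, 5, 6, 7}" by (auto simp: affine_E7_def)
  show "finite (verts affine_E7)" "verts affine_E7 \<noteq> {}" by (simp_all add: v)
  show "e \<subseteq> verts affine_E7 \<and> card e = 2" if "e \<in># edges affine_E7" for e
    using that by (auto simp: affine_E7_def)
  show "0 < ?y u" if "u \<in> verts affine_E7" for u
    using that by (auto simp: v)
  show "(\<Sum>e\<in>#edges affine_E7. if u \<in> e then sum ?y (e - {u}) else 0) = 2 * ?y u"
    if "u \<in> verts affine_E7" for u
    using that[unfolded v] unfolding affine_E7_def multigraph.sel image_mset_add_mset
      sum_mset.insert image_mset_empty sum_mset.empty
    by (subst (1 2 3 4 5 6 7) sum_remove_pair) auto
  show "v \<in> S" if S: "\<And>e. e \<in># edges affine_E7 \<Longrightarrow> e \<subseteq> S \<or> e \<inter> S = {}"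
    "u \<in> S" "v \<in> verts affine_E7" "S \<subseteq> verts affine_E7" for S u v
  proof -
    have "u \<in> verts affine_E7" using S(2,4) by blast
    moreover have "a \<in> S \<longleftrightarrow> b \<in> S" if "{a, b} \<in># edges affine_E7" for a b
      using S(1)[OF that] by blast
    note this[of 0 1] this[of 1 3] this[of 3 4] this[of 4 5] this[of 5 6] this[of 6 7] this[of 4 2]
    ultimately show ?thesis using S(2,3) unfolding v by (simp add: affine_E7_def) blast
  qed
qed

lemma affine_graph_E8:
  "affine_graph affine_E8 (\<lambda>k. [1, 2, 3, 4, 6, 5, 4, 3, 2] ! k)" (is "affine_graph _ ?y")
proof (rule affine_graphI)
  have v: "verts affine_E8 = {0, 1, 2, 3, 4, 5, 6, 7, 8}" by (auto simp: affine_E8_def)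
  show "finite (verts affine_E8)" "verts affine_E8 \<noteq> {}" by (simp_all add: v)
  show "e \<subseteq> verts affine_E8 \<and> card e = 2" if "e \<in># edges affine_E8" for e
    using that by (auto simp: affine_E8_def)
  show "0 < ?y u" if "u \<in> verts affine_E8" for u
    using that by (auto simp: v)
  show "(\<Sum>e\<in>#edges affine_E8. if u \<in> e then sum ?y (e - {u}) else 0) = 2 * ?y u"
    if "u \<in> verts affine_E8" for u
    using that[unfolded v] unfolding affine_E8_def multigraph.sel image_mset_add_mset
      sum_mset.insert image_mset_empty sum_mset.empty
    by (subst (1 2 3 4 5 6 7 8) sum_remove_pair) auto
  show "v \<in> S" if S: "\<And>e. e \<in># edges affine_E8 \<Longrightarrow> e \<subseteq> S \<or> e \<inter> S = {}"
    "u \<in> S" "v \<in> verts affine_E8" "S \<subseteq> verts affine_E8" for S u v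
  proof -
    have "u \<in> verts affine_E8" using S(2,4) by blast
    moreover have "a \<in> S \<longleftrightarrow> b \<in> S" if "{a, b} \<in># edges affine_E8" for a b
      using S(1)[OF that] by blast
    note this[of 1 3] this[of 3 4] this[of 4 5] this[of 5 6] this[of 6 7] this[of 7 8] this[of 8 0] this[of 4 2]
    ultimately show ?thesis using S(2,3) unfolding v by (simp add: affine_E8_def) blast
  qed
qed

lemma count_image_mset_set_le_1:
  assumes "inj_on g K"
  shows "count (image_mset g (mset_set K)) d \<le> 1"
  by (simp add: image_mset_mset_set[OF assms] count_mset_set')

lemma count_edges_A:
  assumes "2 \<le> l"
  shows "count (edges (affine_A l)) d \<le> 1"
proof -
  have "inj_on (\<lambda>k. {k, (k + 1) mod (l + 1)}) {0..l}"
  proof (rule inj_onI)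
    fix j k assume jk: "j \<in> {0..l}" "k \<in> {0..l}" "{j, (j + 1) mod (l + 1)} = {k, (k + 1) mod (l + 1)}"
    have succ: "(i + 1) mod (l + 1) = (if i = l then 0 else i + 1)" if "i \<in> {0..l}" for i
      using that by auto
    show "j = k"
      using jk(3) assms unfolding succ[OF jk(1)] succ[OF jk(2)] doubleton_eq_iff by (auto split: if_splits)
  qed
  then show ?thesis unfolding affine_A_def multigraph.sel by (rule count_image_mset_set_le_1)
qed

lemma count_edges_D:
  assumes "4 \<le> l"
  shows "count (edges (affine_D l)) d \<le> 1"
proof -
  let ?M = "image_mset (\<lambda>k. {k, k + 1}) (mset_set {1..l - 2})"
  have inj: "inj_on (\<lambda>k. {k, k + 1}) {1..l - 2}"
    by (auto simp: inj_on_def doubleton_eq_iff)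
  have "count (edges (affine_D l)) d =
      (if d = {0, 2} then 1 else 0) + count ?M d + (if d = {l - 2, l} then 1 else 0)"
    by (simp add: affine_D_def)
  moreover have "count ?M {0, 2} = 0" "count ?M {l - 2, l} = 0"
    using assms by (auto simp: count_eq_zero_iff doubleton_eq_iff)
  moreover have "{0, 2} \<noteq> {l - 2, l}"
    using assms by (auto simp: doubleton_eq_iff)
  ultimately show ?thesis
    using count_image_mset_set_le_1[OF inj, of d] by auto
qed

lemma count_edges_E:
  "count (edges affine_E6) d \<le> 1" "count (edges affine_E7) d \<le> 1" "count (edges affine_E8) d \<le> 1"
proof -
  have le: "count (mset ds) d \<le> 1" if "distinct ds" for ds
    using that by (simp add: distinct_count_atmost_1)
  show "count (edges affine_E6) d \<le> 1"
    using le[of "[{1, 3}, {3, 4}, {4, 5}, {5, 6}, {4, 2}, {2, 0}]"]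
    by (simp add: affine_E6_def doubleton_eq_iff)
  show "count (edges affine_E7) d \<le> 1"
    using le[of "[{0, 1}, {1, 3}, {3, 4}, {4, 5}, {5, 6}, {6, 7}, {4, 2}]"]
    by (simp add: affine_E7_def doubleton_eq_iff)
  show "count (edges affine_E8) d \<le> 1"
    using le[of "[{1, 3}, {3, 4}, {4, 5}, {5, 6}, {6, 7}, {7, 8}, {8, 0}, {4, 2}]"]
    by (simp add: affine_E8_def doubleton_eq_iff)
qed

lemma affine_graph_model:
  assumes "H \<in> affine_A ` {1..} \<union> affine_D ` {4..} \<union> {affine_E6, affine_E7, affine_E8}"
  shows "\<exists>y. affine_graph H y"
  using assms affine_graph_A affine_graph_D affine_graph_E6 affine_graph_E7 affine_graph_E8
  by (elim UnE imageE) (auto intro: exI)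

lemma affine_graph_dynkin:
  assumes "simply_laced_affine_dynkin G"
  shows "\<exists>x. affine_graph G x"
  using assms affine_graph_model affine_graph_iso unfolding simply_laced_affine_dynkin_def by blast

lemma unit_fraction_triples:
  fixes a b c :: nat
  assumes "1 \<le> a" "a \<le> b" "b \<le> c"
    and "real a / (real a + 1) + real b / (real b + 1) + real c / (real c + 1) = 2"
  shows "(a, b, c) \<in> {(2, 2, 2), (1, 3, 3), (1, 2, 5)}"
proof -
  let ?D = "(real a + 1) * (real b + 1) * (real c + 1)"
  have "real (a * (b + 1) * (c + 1) + b * (a + 1) * (c + 1) + c * (a + 1) * (b + 1)) =
      real a / (real a + 1) * ?D + real b / (real b + 1) * ?D + real c / (real c + 1) * ?D"
    by (simp add: mult_ac) (simp add: algebra_simps)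
  also have "\<dots> = 2 * ?D"
    by (simp only: distrib_right[symmetric] assms(4))
  also have "\<dots> = real (2 * (a + 1) * (b + 1) * (c + 1))"
    by (simp add: algebra_simps)
  finally have e: "a * (b + 1) * (c + 1) + b * (a + 1) * (c + 1) + c * (a + 1) * (b + 1) =
      2 * (a + 1) * (b + 1) * (c + 1)"
    by (simp only: of_nat_eq_iff)
  then have e: "a * b * c = a + b + c + 2" by (simp add: algebra_simps)
  have "a \<le> 2"
  proof (rule ccontr)
    assume "\<not> a \<le> 2"
    then have "3 * 3 * c \<le> a * b * c" using assms by (intro mult_le_mono) auto
    then show False using e assms \<open>\<not> a \<le> 2\<close> by linarith
  qed
  then consider "a = 1" | "a = 2" using assms(1) by linarith
  then show ?thesis
  proof cases
    case 1
    have "b \<le> 3"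
    proof (rule ccontr)
      assume "\<not> b \<le> 3"
      then have "4 * c \<le> b * c" by (intro mult_le_mono) auto
      moreover have "b * c = b + c + 3" using e 1 by simp
      ultimately show False using assms(3) \<open>\<not> b \<le> 3\<close> by linarith
    qed
    then have "b = 1 \<or> b = 2 \<or> b = 3" using assms 1 by linarith
    then show ?thesis using e 1 by auto
  next
    case 2
    have "b \<le> 2"
    proof (rule ccontr)
      assume "\<not> b \<le> 2"
      then have "3 * c \<le> b * c" by (intro mult_le_mono) auto
      moreover have "2 * (b * c) = b + c + 4" using e 2 by simp
      ultimately show False using assms(3) \<open>\<not> b \<le> 2\<close> by linarith
    qed
    then have "b = 2" using assms 2 by linarith
    then show ?thesis using e 2 by auto
  qed
qed

section \<open>The classification\<close>

locale non_dynkin_graph = affine_graph +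
  assumes not_dynkin: "\<not> simply_laced_affine_dynkin G"
begin

lemma no_embedding:
  assumes "H \<in> affine_A ` {1..} \<union> affine_D ` {4..} \<union> {affine_E6, affine_E7, affine_E8}"
    "inj_on f (verts H)" "f ` verts H \<subseteq> verts G" "image_mset ((`) f) (edges H) \<subseteq># edges G"
  shows False
proof -
  obtain y where "affine_graph H y" using affine_graph_model[OF assms(1)] ..
  from affine_graph_embedding[OF affine_graph_axioms this assms(2-4)] assms(1) not_dynkin
  show False unfolding simply_laced_affine_dynkin_def by blast
qed

lemma no_simple_embedding:
  assumes H: "H \<in> affine_A ` {1..} \<union> affine_D ` {4..} \<union> {affine_E6, affine_E7, affine_E8}"
    and simple: "\<And>d. count (edges H) d \<le> 1"
    and inj: "inj_on f (verts H)" and edges: "\<And>d. d \<in># edges H \<Longrightarrow> f ` d \<in># edges G"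
  shows False
proof -
  obtain y where "affine_graph H y" using affine_graph_model[OF H] ..
  then interpret H: affine_graph H y .
  have "f ` verts H \<subseteq> verts G"
  proof
    fix w assume "w \<in> f ` verts H"
    then obtain u where u: "u \<in> verts H" "w = f u" by blast
    have "\<exists>v. {u, v} \<in># edges H"
    proof (rule ccontr)
      assume "\<nexists>v. {u, v} \<in># edges H"
      then have "edge_count H u v = 0" for v
        by (simp add: edge_count_def count_eq_zero_iff)
      then show False using H.label_sum[OF u(1)] H.label_pos[OF u(1)] by simp
    qed
    then show "w \<in> verts G" using edges edge_subset u(2) by blast
  qed
  moreover have "image_mset ((`) f) (edges H) \<subseteq># edges G"
  proof (rule mset_subset_eqI)
    fix e
    show "count (image_mset ((`) f) (edges H)) e \<le> count (edges G) e"
    proof (cases "e \<in># image_mset ((`) f) (edges H)")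
      case True
      then obtain d where d: "d \<in># edges H" "e = f ` d" by auto
      have "count (image_mset ((`) f) (edges H)) e = count (edges H) d"
        unfolding d(2) using inj H.edge_subset d(1) by (intro count_image_mset_image) auto
      then show ?thesis using simple[of d] edges[OF d(1)] d(2)
        by (metis One_nat_def Suc_leI count_greater_zero_iff order_trans)
    next
      case False
      then have "count (image_mset ((`) f) (edges H)) e = 0"
        by (simp only: count_eq_zero_iff not_False_eq_True)
      then show ?thesis by simp
    qed
  qed
  ultimately show False using no_embedding[OF H inj] by blast
qed

lemma count_edges_le_1: "count (edges G) e \<le> 1"
proof (rule ccontr)
  assume c: "\<not> count (edges G) e \<le> 1"
  then have "e \<in># edges G" by (metis count_eq_zero_iff le0)
  then obtain u v where e: "e = {u, v}" "u \<noteq> v" "u \<in> verts G" "v \<in> verts G"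
    by (rule edge_pairE)
  have m: "{0..Suc 0} = {0, 1}" by auto
  show False
  proof (rule no_embedding)
    let ?f = "\<lambda>k::nat. if k = 0 then u else v"
    show "affine_A 1 \<in> affine_A ` {1..} \<union> affine_D ` {4..} \<union> {affine_E6, affine_E7, affine_E8}"
      by blast
    show "inj_on ?f (verts (affine_A 1))" "?f ` verts (affine_A 1) \<subseteq> verts G"
      using e(2-4) by (auto simp: affine_A_def m)
    have "image_mset ((`) ?f) (edges (affine_A 1)) = {#{u, v}, {u, v}#}"
      by (simp add: affine_A_def m insert_commute)
    also have "\<dots> \<subseteq># edges G"
      using c e(1) by (intro mset_subset_eqI) auto
    finally show "image_mset ((`) ?f) (edges (affine_A 1)) \<subseteq># edges G" .
  qed
qed

lemma no_cycle:
  assumes "3 \<le> d" "inj_on c {..<d}" "\<And>i. Suc i < d \<Longrightarrow> {c i, c (Suc i)} \<in># edges G"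
    "{c (d - 1), c 0} \<in># edges G"
  shows False
proof (rule no_simple_embedding)
  show "affine_A (d - 1) \<in> affine_A ` {1..} \<union> affine_D ` {4..} \<union> {affine_E6, affine_E7, affine_E8}"
    using assms(1) by auto
  show "count (edges (affine_A (d - 1))) e \<le> 1" for e
    using assms(1) by (intro count_edges_A) auto
  show "inj_on c (verts (affine_A (d - 1)))"
    using assms(1) by (intro inj_on_subset[OF assms(2)]) (auto simp: affine_A_def)
  show "c ` e \<in># edges G" if e: "e \<in># edges (affine_A (d - 1))" for e
  proof -
    obtain k where k: "k \<le> d - 1" "e = {k, (k + 1) mod d}"
      using e assms(1) by (auto simp: affine_A_def)
    show ?thesis
    proof (cases "k = d - 1")
      case True
      then show ?thesis using k assms(1,4) by simp
    next
      case False
      then show ?thesis using k assms(1) assms(3)[of k] by simp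
    qed
  qed
qed

definition reduced_walk :: "(nat \<Rightarrow> 'a) \<Rightarrow> nat \<Rightarrow> bool" where
  "reduced_walk p n \<longleftrightarrow> (\<forall>i<n. {p i, p (Suc i)} \<in># edges G) \<and> (\<forall>i. i + 2 \<le> n \<longrightarrow> p i \<noteq> p (i + 2))"

lemma reduced_walk_edge: "reduced_walk p n \<Longrightarrow> i < n \<Longrightarrow> {p i, p (Suc i)} \<in># edges G"
  by (simp add: reduced_walk_def)

lemma reduced_walk_edge': "reduced_walk p n \<Longrightarrow> i < n \<Longrightarrow> {p (Suc i), p i} \<in># edges G"
  by (simp add: reduced_walk_def insert_commute)

lemma reduced_walk_neq: "reduced_walk p n \<Longrightarrow> i + 2 \<le> n \<Longrightarrow> p i \<noteq> p (i + 2)"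
  unfolding reduced_walk_def by blast

text \<open>A shortest closed stretch of a reduced walk would be a cycle.\<close>

lemma reduced_walk_inj:
  assumes "reduced_walk p n"
  shows "inj_on p {..n}"
proof (rule ccontr)
  assume "\<not> inj_on p {..n}"
  then obtain i j where ij: "i < j" "j \<le> n" "p i = p j"
    using linorder_inj_onI'[of "{..n}" p] by blast
  have "0 < j - i" "i + (j - i) \<le> n" "p i = p (i + (j - i))"
    using ij by simp_all
  then have ex: "\<exists>d>0. \<exists>i. i + d \<le> n \<and> p i = p (i + d)"
    by blast
  define d where "d = (LEAST d. d > 0 \<and> (\<exists>i. i + d \<le> n \<and> p i = p (i + d)))"
  have "d > 0 \<and> (\<exists>i. i + d \<le> n \<and> p i = p (i + d))"
    unfolding d_def by (rule LeastI_ex) (fact ex)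
  then obtain i where d: "d > 0" "i + d \<le> n" "p i = p (i + d)" by blast
  have least: "d \<le> e" if "e > 0" "k + e \<le> n" "p k = p (k + e)" for e k
    unfolding d_def using that by (intro Least_le) blast
  have "d \<noteq> 1"
    using reduced_walk_edge[OF assms, of i] d(2,3) not_loop[of "p i"] by auto
  moreover have "d \<noteq> 2"
    using reduced_walk_neq[OF assms, of i] d(2,3) by metis
  ultimately have "3 \<le> d" using d(1) by simp
  then show False
  proof (rule no_cycle)
    have "p (i + j) \<noteq> p (i + k)" if "j < k" "k < d" for j k
    proof
      assume "p (i + j) = p (i + k)"
      then have "d \<le> k - j" using least[of "k - j" "i + j"] that d(2) by simp
      then show False using that by simp
    qed
    then show "inj_on (\<lambda>k. p (i + k)) {..<d}"
      by (intro linorder_inj_onI') auto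
    show "{p (i + k), p (i + Suc k)} \<in># edges G" if "Suc k < d" for k
      using reduced_walk_edge[OF assms, of "i + k"] that d(2) by simp
    show "{p (i + (d - 1)), p (i + 0)} \<in># edges G"
    proof -
      have "Suc (i + (d - 1)) = i + d" using d(1) by simp
      then show ?thesis using reduced_walk_edge[OF assms, of "i + (d - 1)"] d by (metis add_0_right less_le_trans lessI)
    qed
  qed
qed

lemma no_two_branches:
  assumes p: "reduced_walk p n" "2 \<le> n"
    and b: "{p 1, b} \<in># edges G" "b \<noteq> p 0" "b \<noteq> p 2"
    and d: "{p (n - 1), d} \<in># edges G" "d \<noteq> p n" "d \<noteq> p (n - 2)"
    and bd: "n = 2 \<Longrightarrow> b \<noteq> d"
  shows False
proof (rule no_simple_embedding)
  let ?f = "\<lambda>k. if k = 0 then b else if k = n + 2 then d else p (k - 1)"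
  show "affine_D (n + 2) \<in> affine_A ` {1..} \<union> affine_D ` {4..} \<union> {affine_E6, affine_E7, affine_E8}"
    using p(2) by auto
  show "count (edges (affine_D (n + 2))) e \<le> 1" for e
    using p(2) by (intro count_edges_D) auto
  have b': "{b, p (Suc 0)} \<in># edges G" using b(1) by (simp add: insert_commute)
  have d': "{p i, d} \<in># edges G" if "Suc i = n" for i using d(1) that by auto
  have d'': "p i \<noteq> d" if "i + 2 = n" for i using d(3) that by auto
  have e: "{p i, p (Suc i)} \<in># edges G" if "i < n" for i
    using reduced_walk_edge[OF p(1) that] .
  have ne: "p i \<noteq> p (Suc (Suc i))" if "Suc (Suc i) \<le> n" for i
    using reduced_walk_neq[OF p(1), of i] that by simp
  have b2: "b \<noteq> p (Suc (Suc 0))" using b(3) by (simp add: numeral_2_eq_2)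
  have 1: "reduced_walk (p(0 := b)) n"
    unfolding reduced_walk_def using e ne b' b2 by simp
  have 2: "reduced_walk (p(n := d)) n"
    unfolding reduced_walk_def using e ne d' d'' p(2) by simp
  have 3: "reduced_walk (p(0 := b, n := d)) n"
    unfolding reduced_walk_def using e ne b' b2 d' d'' bd p(2) by simp
  note inj = reduced_walk_inj[THEN inj_onD]
  have pp: "i = j" if "p i = p j" "i \<le> n" "j \<le> n" for i j
    using inj[OF p(1)] that by auto
  have pb: "p i \<noteq> b" if "i \<le> n" for i
    using inj[OF 1, of i 0] that b(2) by (cases "i = 0") auto
  have pd: "p i \<noteq> d" if "i \<le> n" for i
    using inj[OF 2, of i n] that d(2) by (cases "i = n") auto
  have "b \<noteq> d"
    using inj[OF 3, of 0 n] p(2) by auto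
  have "?f u \<noteq> ?f v" if "u < v" "v \<le> n + 2" for u v
  proof (cases "v = n + 2")
    case True
    then show ?thesis using that(1) pd[of "u - 1"] \<open>b \<noteq> d\<close> by (cases u) auto
  next
    case False
    then have v: "v - 1 \<le> n" using that by linarith
    show ?thesis
    proof (cases "u = 0")
      case True
      then show ?thesis using that False pb[OF v] by auto
    next
      case u: False
      then have "u - 1 \<le> n" "u - 1 \<noteq> v - 1" using that v by linarith+
      then have "p (u - 1) \<noteq> p (v - 1)" using pp[of "u - 1" "v - 1"] v by metis
      then show ?thesis using that False u by simp
    qed
  qed
  then show "inj_on ?f (verts (affine_D (n + 2)))"
    by (intro linorder_inj_onI') (simp add: affine_D_def)
  show "?f ` e \<in># edges G" if e: "e \<in># edges (affine_D (n + 2))" for e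
  proof -
    from e consider "e = {0, 2}" | k where "k < n" "e = {Suc k, Suc (Suc k)}" | "e = {n, n + 2}"
    proof -
      from e have "e = {0, 2} \<or> (\<exists>j\<in>{1..n}. e = {j, j + 1}) \<or> e = {n, n + 2}"
        by (auto simp: affine_D_def)
      then show thesis
      proof (elim disjE bexE)
        fix j assume j: "j \<in> {1..n}" "e = {j, j + 1}"
        then show thesis using that(2)[of "j - 1"] by (cases j) auto
      qed (use that in blast)+
    qed
    then show ?thesis
    proof cases
      case 2
      then show ?thesis using reduced_walk_edge[OF p(1), of k] by simp
    next
      case 3
      then show ?thesis using d(1) p(2) by simp
    next
      case 1
      then have "?f ` e = {b, p (Suc 0)}" using p(2) by auto
      then show ?thesis using b' by simp
    qed
  qed
qed

definition nbrs :: "'a \<Rightarrow> 'a set" where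
  "nbrs u = {v. {u, v} \<in># edges G}"

lemma nbrs_subset: "nbrs u \<subseteq> verts G"
  using edge_subset by (auto simp: nbrs_def)

lemma finite_nbrs: "finite (nbrs u)"
  using nbrs_subset finite_verts by (rule finite_subset)

lemma sum_nbrs:
  assumes "u \<in> verts G"
  shows "(\<Sum>v\<in>nbrs u. x v) = 2 * x u"
proof -
  have ec: "edge_count G u v = (if v \<in> nbrs u then 1 else 0)" for v
  proof (cases "v \<in> nbrs u")
    case True
    then have "0 < count (edges G) {u, v}" by (simp add: nbrs_def)
    then have "count (edges G) {u, v} = 1" using count_edges_le_1[of "{u, v}"] by linarith
    then show ?thesis using True by (simp add: edge_count_def)
  qed (simp add: edge_count_def nbrs_def count_eq_zero_iff)
  have "(\<Sum>v\<in>nbrs u. x v) = (\<Sum>v\<in>verts G. real (edge_count G u v) * x v)"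
    using finite_verts nbrs_subset by (intro sum.mono_neutral_cong_left) (auto simp: ec)
  then show ?thesis using label_sum[OF assms] by simp
qed

lemma card_nbrs_pos:
  assumes "u \<in> verts G"
  shows "0 < card (nbrs u)"
proof (rule ccontr)
  assume "\<not> 0 < card (nbrs u)"
  then have "nbrs u = {}" using finite_nbrs by simp
  then show False using sum_nbrs[OF assms] label_pos[OF assms] by simp
qed

lemma card_nbrs_le_3: "card (nbrs u) \<le> 3"
proof (rule ccontr)
  assume "\<not> card (nbrs u) \<le> 3"
  then obtain T where T: "T \<subseteq> nbrs u" "card T = Suc (Suc (Suc (Suc 0)))"
    by (metis not_less_eq_eq numeral_3_eq_3 obtain_subset_with_card_n)
  then obtain a b c d where abcd: "T = {a, b, c, d}" "distinct [a, b, c, d]"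
    by (auto simp: card_Suc_eq)
  let ?p = "\<lambda>i::nat. if i = 0 then a else if i = 1 then u else c"
  have e: "{u, a} \<in># edges G" "{u, b} \<in># edges G" "{u, c} \<in># edges G" "{u, d} \<in># edges G"
    using T(1) abcd(1) by (auto simp: nbrs_def)
  show False
  proof (rule no_two_branches[of ?p 2 b d])
    show "reduced_walk ?p 2"
      using e abcd(2) unfolding reduced_walk_def by (auto simp: less_2_cases_iff insert_commute)
  qed (use e abcd(2) in auto)
qed

definition arm :: "(nat \<Rightarrow> 'a) \<Rightarrow> nat \<Rightarrow> bool" where
  "arm p n \<longleftrightarrow> 1 \<le> n \<and> reduced_walk p n \<and> (\<forall>i. 0 < i \<and> i < n \<longrightarrow> card (nbrs (p i)) = 2)"

lemma reduced_walk_verts: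
  assumes "reduced_walk p n" "1 \<le> n" "i \<le> n"
  shows "p i \<in> verts G"
proof (cases "i < n")
  case True
  then show ?thesis using edge_subset[OF reduced_walk_edge[OF assms(1) True]] by simp
next
  case False
  then show ?thesis using edge_subset[OF reduced_walk_edge[OF assms(1), of "n - 1"]] assms(2,3) by simp
qed

lemma reduced_walk_length:
  assumes "reduced_walk p n" "1 \<le> n"
  shows "n < card (verts G)"
proof -
  have "card {..n} \<le> card (verts G)"
    using reduced_walk_inj[OF assms(1)] reduced_walk_verts[OF assms] finite_verts
    by (intro card_inj_on_le[of p]) auto
  then show ?thesis by simp
qed

lemma reduced_walk_extend:
  assumes "reduced_walk p n" "1 \<le> n" "z \<in> nbrs (p n)" "z \<noteq> p (n - 1)"
  shows "reduced_walk (p(Suc n := z)) (Suc n)"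
proof -
  have "p i \<noteq> z" if "Suc i = n" for i using assms(4) that by auto
  then show ?thesis
    using assms(1,3) unfolding reduced_walk_def nbrs_def by (auto simp: less_Suc_eq le_Suc_eq)
qed

lemma arm_extend:
  assumes "arm p n" "card (nbrs (p n)) = 2"
  shows "\<exists>z. arm (p(Suc n := z)) (Suc n)"
proof -
  have "\<not> nbrs (p n) \<subseteq> {p (n - 1)}"
    using card_mono[of "{p (n - 1)}" "nbrs (p n)"] assms(2) by auto
  then obtain z where "z \<in> nbrs (p n)" "z \<noteq> p (n - 1)" by blast
  then show ?thesis
    using assms reduced_walk_extend[of p n z] unfolding arm_def
    by (intro exI[of _ z]) (auto simp: less_Suc_eq)
qed

lemma ex_arm:
  assumes "w \<in> nbrs u"
  obtains p n where "arm p n" "p 0 = u" "p 1 = w" "card (nbrs (p n)) \<noteq> 2"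
proof -
  let ?P = "\<lambda>n. \<exists>p. arm p n \<and> p 0 = u \<and> p 1 = w"
  have "arm (\<lambda>i. if i = 0 then u else w) 1"
    using assms by (auto simp: arm_def reduced_walk_def nbrs_def)
  then have 1: "?P 1" by (intro exI[of _ "\<lambda>i. if i = 0 then u else w"]) auto
  have bound: "\<And>n. ?P n \<Longrightarrow> n \<le> card (verts G)"
    using reduced_walk_length unfolding arm_def by (meson less_imp_le)
  define n where "n = (GREATEST n. ?P n)"
  have "?P n" unfolding n_def using GreatestI_nat[of ?P, OF 1 bound] .
  then obtain p where p: "arm p n" "p 0 = u" "p 1 = w" by blast
  have "card (nbrs (p n)) \<noteq> 2"
  proof
    assume "card (nbrs (p n)) = 2"
    then obtain z where z: "arm (p(Suc n := z)) (Suc n)" using arm_extend[OF p(1)] by blast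
    have "?P (Suc n)"
      using z p by (intro exI[of _ "p(Suc n := z)"]) (auto simp: arm_def)
    then have "Suc n \<le> n" unfolding n_def by (rule Greatest_le_nat[OF _ bound])
    then show False by simp
  qed
  with p show thesis by (rule that)
qed

lemma nbrs_arm_interior:
  assumes "arm p n" "0 < i" "i < n"
  shows "nbrs (p i) = {p (i - 1), p (i + 1)}" "p (i - 1) \<noteq> p (i + 1)"
proof -
  have w: "reduced_walk p n" and c: "card (nbrs (p i)) = 2"
    using assms by (auto simp: arm_def)
  show ne: "p (i - 1) \<noteq> p (i + 1)"
    using reduced_walk_neq[OF w, of "i - 1"] assms(2,3) by (cases i) auto
  have "{p (i - 1), p (i + 1)} \<subseteq> nbrs (p i)"
    using reduced_walk_edge[OF w, of i] reduced_walk_edge'[OF w, of "i - 1"] assms(2,3)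
    by (simp add: nbrs_def)
  then show "nbrs (p i) = {p (i - 1), p (i + 1)}"
    using c ne finite_nbrs by (intro card_subset_eq[symmetric]) auto
qed

lemma arm_label:
  assumes "arm p n" "card (nbrs (p n)) = 1" "i \<le> n"
  shows "x (p (n - i)) = (real i + 1) * x (p n)"
  using assms(3)
proof (induction i rule: less_induct)
  case (less i)
  have w: "reduced_walk p n" and n: "1 \<le> n" using assms(1) by (auto simp: arm_def)
  consider "i = 0" | "i = 1" | "2 \<le> i" by linarith
  then show ?case
  proof cases
    case 2
    have "p (n - 1) \<in> nbrs (p n)"
      using reduced_walk_edge'[OF w, of "n - 1"] n by (simp add: nbrs_def)
    then have "nbrs (p n) = {p (n - 1)}"
      using assms(2) by (metis card_1_singletonE singletonD)
    then show ?thesis using sum_nbrs[OF reduced_walk_verts[OF w n, of n]] 2 by simp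
  next
    case 3
    define j where "j = n - (i - 1)"
    have j: "0 < j" "j < n" "j - 1 = n - i" "j + 1 = n - (i - 2)"
      using 3 less.prems by (auto simp: j_def)
    have "x (p (n - i)) + x (p (n - (i - 2))) = 2 * x (p j)"
      using sum_nbrs[OF reduced_walk_verts[OF w n, of j]] nbrs_arm_interior[OF assms(1) j(1,2)] j by simp
    moreover have "x (p j) = (real (i - 1) + 1) * x (p n)"
      "x (p (n - (i - 2))) = (real (i - 2) + 1) * x (p n)"
      unfolding j_def using less.IH[of "i - 1"] less.IH[of "i - 2"] 3 less.prems by auto
    ultimately show ?thesis using 3 by (simp add: of_nat_diff algebra_simps)
  qed simp
qed

lemma arm_label_first:
  assumes "arm p n" "card (nbrs (p n)) = 1"
  shows "x (p 1) = real n / (real n + 1) * x (p 0)"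
proof -
  have n: "1 \<le> n" using assms(1) by (simp add: arm_def)
  have "x (p 0) = (real n + 1) * x (p n)" using arm_label[OF assms, of n] by simp
  moreover have "x (p 1) = real n * x (p n)" using arm_label[OF assms, of "n - 1"] n by (simp add: of_nat_diff)
  ultimately show ?thesis by (simp add: field_simps)
qed

lemma ex_branching: "\<exists>u\<in>verts G. card (nbrs u) = 3"
proof -
  have three: "card (nbrs (p n)) = 3" if "arm p n" "card (nbrs (p n)) \<noteq> 2" "card (nbrs (p n)) \<noteq> 1" for p n
    using that card_nbrs_le_3[of "p n"] card_nbrs_pos[of "p n"] reduced_walk_verts[of p n n]
    by (auto simp: arm_def)
  obtain u where u: "u \<in> verts G" using verts_nonempty by blast
  then obtain w where "w \<in> nbrs u" using card_nbrs_pos by (metis card.empty equals0I less_irrefl)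
  then obtain p n where p: "arm p n" "card (nbrs (p n)) \<noteq> 2" by (rule ex_arm)
  then have pn: "p n \<in> verts G" using reduced_walk_verts[of p n n] by (simp add: arm_def)
  show ?thesis
  proof (cases "card (nbrs (p n)) = 1")
    case True
    then obtain z where z: "nbrs (p n) = {z}" by (rule card_1_singletonE)
    then have "z \<in> nbrs (p n)" by simp
    then obtain q m where q: "arm q m" "q 0 = p n" "q 1 = z" "card (nbrs (q m)) \<noteq> 2"
      by (rule ex_arm)
    have "card (nbrs (q m)) \<noteq> 1"
    proof
      assume "card (nbrs (q m)) = 1"
      from arm_label_first[OF q(1) this] have "x z = real m / (real m + 1) * x (p n)"
        by (simp only: q(2,3))
      moreover have "x z = 2 * x (p n)" using sum_nbrs[OF pn] z by simp
      moreover have "real m / (real m + 1) * x (p n) < 2 * x (p n)"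
        using label_pos[OF pn] by (intro mult_strict_right_mono) (simp_all add: divide_simps)
      ultimately show False by simp
    qed
    then show ?thesis using three[OF q(1)] q reduced_walk_verts[of q m m] by (auto simp: arm_def)
  next
    case False
    then show ?thesis using three[OF p(1)] p pn by blast
  qed
qed

lemma arm_ends_in_leaf:
  assumes p: "arm p n" "card (nbrs (p n)) \<noteq> 2" and u: "card (nbrs (p 0)) = 3"
  shows "card (nbrs (p n)) = 1"
proof (rule ccontr)
  assume "card (nbrs (p n)) \<noteq> 1"
  have w: "reduced_walk p n" and n: "1 \<le> n" using p(1) by (auto simp: arm_def)
  have c3: "card (nbrs (p n)) = 3"
    using \<open>card (nbrs (p n)) \<noteq> 1\<close> p(2) card_nbrs_le_3[of "p n"]
      card_nbrs_pos[OF reduced_walk_verts[OF w n order_refl]] by linarith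
  have two: "\<exists>a b. a \<in> nbrs v \<and> b \<in> nbrs v \<and> a \<noteq> b \<and> a \<noteq> z \<and> b \<noteq> z" if "card (nbrs v) = 3" for v z
  proof -
    have "2 \<le> card (nbrs v - {z})" using that by (simp add: card_Diff_singleton_if)
    then obtain T where "T \<subseteq> nbrs v - {z}" "card T = 2" by (metis obtain_subset_with_card_n)
    then show ?thesis by (auto simp: card_2_iff)
  qed
  obtain a b where ab: "a \<in> nbrs (p 0)" "b \<in> nbrs (p 0)" "a \<noteq> b" "a \<noteq> p 1" "b \<noteq> p 1"
    using two[OF u] by metis
  obtain c d where cd: "c \<in> nbrs (p n)" "d \<in> nbrs (p n)" "c \<noteq> d" "c \<noteq> p (n - 1)" "d \<noteq> p (n - 1)"
    using two[OF c3] by metis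
  have w': "reduced_walk (p(Suc n := c)) (Suc n)"
    using reduced_walk_extend[OF w n cd(1,4)] .
  let ?q = "\<lambda>i. case i of 0 \<Rightarrow> a | Suc j \<Rightarrow> (p(Suc n := c)) j"
  show False
  proof (rule no_two_branches[of ?q "n + 2" b d])
    show "reduced_walk ?q (n + 2)"
      unfolding reduced_walk_def
    proof (intro conjI allI impI)
      show "{?q i, ?q (Suc i)} \<in># edges G" if "i < n + 2" for i
        using that ab(1) reduced_walk_edge[OF w', of "i - 1"]
        by (cases i) (auto simp: nbrs_def insert_commute)
      show "?q i \<noteq> ?q (i + 2)" if "i + 2 \<le> n + 2" for i
        using that ab(4) n reduced_walk_neq[OF w', of "i - 1"] by (cases i) auto
    qed
  qed (use ab cd n in \<open>auto simp: nbrs_def numeral_2_eq_2 split: nat.splits\<close>)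
qed

lemma arms_disjoint:
  assumes p: "reduced_walk p n" and q: "reduced_walk q m" and pq: "p 0 = q 0" "p 1 \<noteq> q 1"
    and ij: "1 \<le> i" "i \<le> n" "j \<le> m"
  shows "p i \<noteq> q j"
proof -
  let ?r = "\<lambda>k. if k \<le> n then p (n - k) else q (k - n)"
  have "reduced_walk ?r (n + m)"
    unfolding reduced_walk_def
  proof (intro conjI allI impI)
    fix k
    show "{?r k, ?r (Suc k)} \<in># edges G" if k: "k < n + m"
    proof -
      consider "k < n" | "k = n" | "n < k" by linarith
      then show ?thesis
      proof cases
        case 1
        then have "n - k = Suc (n - Suc k)" by simp
        then show ?thesis using 1 reduced_walk_edge'[OF p, of "n - Suc k"] by simp
      next
        case 2
        then show ?thesis using k reduced_walk_edge[OF q, of 0] pq(1) by simp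
      next
        case 3
        then show ?thesis using k reduced_walk_edge[OF q, of "k - n"] by (simp add: Suc_diff_le)
      qed
    qed
    show "?r k \<noteq> ?r (k + 2)" if k: "k + 2 \<le> n + m"
    proof -
      consider "k + 2 \<le> n" | "k + 1 = n" | "n \<le> k" by linarith
      then show ?thesis
      proof cases
        case 1
        then have "n - k = (n - (k + 2)) + 2" by simp
        then show ?thesis using 1 reduced_walk_neq[OF p, of "n - (k + 2)"] by (metis diff_le_self le_add1 le_trans)
      next
        case 2
        then have "n - k = 1" "k + 2 - n = 1" by auto
        then show ?thesis using pq(2) 2 by simp
      next
        case 3
        then have e: "k + 2 - n = (k - n) + 2" by simp
        have "q (k - n) \<noteq> q (k - n + 2)" using 3 k by (intro reduced_walk_neq[OF q]) simp
        moreover have "?r k = q (k - n)" using 3 pq(1) by auto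
        ultimately show ?thesis using 3 e by simp
      qed
    qed
  qed
  then have "inj_on ?r {..n + m}" by (rule reduced_walk_inj)
  then have "?r (n - i) \<noteq> ?r (n + j)" using ij by (subst inj_on_eq_iff) auto
  then show ?thesis using ij pq(1) by (cases "j = 0") auto
qed

lemma no_three_arms:
  assumes w: "reduced_walk p a" "reduced_walk q b" "reduced_walk r c"
    and start: "p 0 = u" "q 0 = u" "r 0 = u" and ne: "p 1 \<noteq> q 1" "p 1 \<noteq> r 1" "q 1 \<noteq> r 1"
    and abc: "(a, b, c) \<in> {(2, 2, 2), (1, 3, 3), (1, 2, 5)}"
  shows False
proof -
  have inj: "p i \<noteq> p j" if "i < j" "j \<le> a" for i j
    using reduced_walk_inj[OF w(1)] that by (auto dest: inj_onD)
  have inj': "q i \<noteq> q j" if "i < j" "j \<le> b" for i j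
    using reduced_walk_inj[OF w(2)] that by (auto dest: inj_onD)
  have inj'': "r i \<noteq> r j" if "i < j" "j \<le> c" for i j
    using reduced_walk_inj[OF w(3)] that by (auto dest: inj_onD)
  have pq: "p i \<noteq> q j" if "1 \<le> i" "i \<le> a" "j \<le> b" for i j
    using arms_disjoint[OF w(1,2)] start ne that by auto
  have pr: "p i \<noteq> r j" if "1 \<le> i" "i \<le> a" "j \<le> c" for i j
    using arms_disjoint[OF w(1,3)] start ne that by auto
  have qr: "q i \<noteq> r j" if "1 \<le> i" "i \<le> b" "j \<le> c" for i j
    using arms_disjoint[OF w(2,3)] start ne that by auto
  have fin: False
    if "distinct xs" "verts H = {..<length xs}" "\<And>d. d \<in># edges H \<Longrightarrow> (!) xs ` d \<in># edges G"
      "H \<in> {affine_E6, affine_E7, affine_E8}" for H xs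
  proof (rule no_simple_embedding[of H "(!) xs"])
    show "count (edges H) d \<le> 1" for d using that(4) count_edges_E by auto
    show "inj_on ((!) xs) (verts H)" using that(1,2) by (auto intro: inj_on_nth)
  qed (use that in auto)
  have pu: "p i \<noteq> u" if "1 \<le> i" "i \<le> a" for i
    using inj[of 0 i] start that by auto
  have pe: "{p i, p j} \<in># edges G" if "j = Suc i \<or> i = Suc j" "i \<le> a" "j \<le> a" for i j
    using that reduced_walk_edge[OF w(1), of i] reduced_walk_edge'[OF w(1), of j] by auto
  have p0: "{u, p 1} \<in># edges G" "{p 1, u} \<in># edges G" if "1 \<le> a"
    using pe[of 0 1] pe[of 1 0] that start by (simp_all add: insert_commute)
  have qu: "q i \<noteq> u" if "1 \<le> i" "i \<le> b" for i
    using inj'[of 0 i] start that by auto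
  have qe: "{q i, q j} \<in># edges G" if "j = Suc i \<or> i = Suc j" "i \<le> b" "j \<le> b" for i j
    using that reduced_walk_edge[OF w(2), of i] reduced_walk_edge'[OF w(2), of j] by auto
  have q0: "{u, q 1} \<in># edges G" "{q 1, u} \<in># edges G" if "1 \<le> b"
    using qe[of 0 1] qe[of 1 0] that start by (simp_all add: insert_commute)
  have ru: "r i \<noteq> u" if "1 \<le> i" "i \<le> c" for i
    using inj''[of 0 i] start that by auto
  have re: "{r i, r j} \<in># edges G" if "j = Suc i \<or> i = Suc j" "i \<le> c" "j \<le> c" for i j
    using that reduced_walk_edge[OF w(3), of i] reduced_walk_edge'[OF w(3), of j] by auto
  have r0: "{u, r 1} \<in># edges G" "{r 1, u} \<in># edges G" if "1 \<le> c"
    using re[of 0 1] re[of 1 0] that start by (simp_all add: insert_commute)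
  note ne = pu qu ru pu[symmetric] qu[symmetric] ru[symmetric] inj inj' inj'' inj[symmetric]
    inj'[symmetric] inj''[symmetric] pq pr qr pq[symmetric] pr[symmetric] qr[symmetric]
  note e = pe qe re p0[simplified] q0[simplified] r0[simplified]
  consider "a = 2" "b = 2" "c = 2" | "a = 1" "b = 3" "c = 3" | "a = 1" "b = 2" "c = 5"
    using abc by auto
  then show False
  proof cases
    case 1
    show False
    proof (rule fin[of "[p 2, q 2, p 1, q 1, u, r 1, r 2]" affine_E6])
      show "distinct [p 2, q 2, p 1, q 1, u, r 1, r 2]"
        using 1 by (simp add: ne)
      show "(!) [p 2, q 2, p 1, q 1, u, r 1, r 2] ` d \<in># edges G" if "d \<in># edges affine_E6" for d
        using that 1 e by (auto simp: affine_E6_def)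
    qed (auto simp: affine_E6_def)
  next
    case 2
    show False
    proof (rule fin[of "[q 3, q 2, p 1, q 1, u, r 1, r 2, r 3]" affine_E7])
      show "distinct [q 3, q 2, p 1, q 1, u, r 1, r 2, r 3]"
        using 2 by (simp add: ne)
      show "(!) [q 3, q 2, p 1, q 1, u, r 1, r 2, r 3] ` d \<in># edges G" if "d \<in># edges affine_E7" for d
        using that 2 e by (auto simp: affine_E7_def)
    qed (auto simp: affine_E7_def)
  next
    case 3
    show False
    proof (rule fin[of "[r 5, q 2, p 1, q 1, u, r 1, r 2, r 3, r 4]" affine_E8])
      show "distinct [r 5, q 2, p 1, q 1, u, r 1, r 2, r 3, r 4]"
        using 3 by (simp add: ne)
      show "(!) [r 5, q 2, p 1, q 1, u, r 1, r 2, r 3, r 4] ` d \<in># edges G" if "d \<in># edges affine_E8" for d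
        using that 3 e by (auto simp: affine_E8_def)
    qed (auto simp: affine_E8_def)
  qed
qed

end

lemma (in affine_graph) simply_laced: "simply_laced_affine_dynkin G"
proof (rule ccontr)
  assume "\<not> simply_laced_affine_dynkin G"
  then interpret non_dynkin_graph G x by unfold_locales
  obtain u where u: "u \<in> verts G" "card (nbrs u) = 3" using ex_branching by blast
  then obtain w1 w2 w3 where w: "nbrs u = {w1, w2, w3}" "w1 \<noteq> w2" "w1 \<noteq> w3" "w2 \<noteq> w3"
    by (auto simp: card_Suc_eq numeral_3_eq_3)
  define A where "A w n p \<longleftrightarrow> arm p n \<and> p 0 = u \<and> p 1 = w \<and> card (nbrs (p n)) = 1" for w n p
  have "\<exists>n p. A w n p" if "w \<in> nbrs u" for w
    using ex_arm[OF that] arm_ends_in_leaf u(2) unfolding A_def by metis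
  then have "\<exists>n p. A w1 n p" "\<exists>n p. A w2 n p" "\<exists>n p. A w3 n p" by (simp_all add: w(1))
  then obtain n1 p1 n2 p2 n3 p3 where arms: "A w1 n1 p1" "A w2 n2 p2" "A w3 n3 p3" by metis
  have lab: "x w = real n / (real n + 1) * x u" if "A w n p" for w n p
    using that arm_label_first[of p n] by (auto simp: A_def)
  have "x w1 + x w2 + x w3 = 2 * x u" using sum_nbrs[OF u(1)] w by simp
  then have "(real n1 / (real n1 + 1) + real n2 / (real n2 + 1) + real n3 / (real n3 + 1)) * x u = 2 * x u"
    using arms[THEN lab] by (simp add: algebra_simps)
  then have sum: "real n1 / (real n1 + 1) + real n2 / (real n2 + 1) + real n3 / (real n3 + 1) = 2"
    using label_pos[OF u(1)] by simp
  have no: False if "A a i p" "A b j q" "A c k r" "a \<noteq> b" "a \<noteq> c" "b \<noteq> c" "i \<le> j" "j \<le> k"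
    "real i / (real i + 1) + real j / (real j + 1) + real k / (real k + 1) = 2" for a b c i j k p q r
    using no_three_arms[of p i q j r k u] unit_fraction_triples[of i j k] that
    by (auto simp: A_def arm_def)
  consider "n1 \<le> n2" "n2 \<le> n3" | "n1 \<le> n3" "n3 \<le> n2" | "n2 \<le> n1" "n1 \<le> n3"
    | "n2 \<le> n3" "n3 \<le> n1" | "n3 \<le> n1" "n1 \<le> n2" | "n3 \<le> n2" "n2 \<le> n1"
    by linarith
  then show False
  proof cases
    case 1
    then show False using no[OF arms(1) arms(2) arms(3)] w(2-4) sum by (simp add: add_ac)
  next
    case 2
    then show False using no[OF arms(1) arms(3) arms(2)] w(2-4) sum by (simp add: add_ac)
  next
    case 3
    then show False using no[OF arms(2) arms(1) arms(3)] w(2-4) sum by (simp add: add_ac)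
  next
    case 4
    then show False using no[OF arms(2) arms(3) arms(1)] w(2-4) sum by (simp add: add_ac)
  next
    case 5
    then show False using no[OF arms(3) arms(1) arms(2)] w(2-4) sum by (simp add: add_ac)
  next
    case 6
    then show False using no[OF arms(3) arms(2) arms(1)] w(2-4) sum by (simp add: add_ac)
  qed
qed

section \<open>Matrices and diagrams\<close>

lemma permutes_of_bij_betw:
  assumes "bij_betw V {..<r} X" "bij_betw V' {..<r} X"
  shows "\<exists>p. p permutes {..<r} \<and> (\<forall>i<r. V' i = V (p i))"
proof -
  let ?g = "\<lambda>i. inv_into {..<r} V (V' i)"
  let ?p = "\<lambda>i. if i < r then ?g i else i"
  have "bij_betw ?g {..<r} {..<r}"
    using bij_betw_trans[OF assms(2) bij_betw_inv_into[OF assms(1)]] by (simp add: comp_def)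
  then have "bij_betw ?p {..<r} {..<r}"
    by (rule bij_betw_cong[THEN iffD1, rotated]) simp
  then have "?p permutes {..<r}"
    by (rule bij_imp_permutes) simp
  moreover have "V' i = V (?p i)" if "i < r" for i
    using that assms by (simp add: bij_betw_inv_into_right bij_betwE)
  ultimately show ?thesis by blast
qed

lemma dim_diagram_matrix [simp]:
  "dim_row (diagram_matrix G r s V W) = r" "dim_col (diagram_matrix G r s V W) = s"
  by (simp_all add: diagram_matrix_def)

lemma diagram_matrix_index [simp]:
  "i < r \<Longrightarrow> j < s \<Longrightarrow> diagram_matrix G r s V W $$ (i, j) = edge_count G (V i) (W j)"
  by (simp add: diagram_matrix_def)

lemma bicolored_affine_graphE:
  assumes "(G, Black, White) \<in> bicolored_affine_diagrams"
  obtains x where "affine_graph G x"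
  using assms affine_graph_dynkin[of G] by (auto simp: bicolored_affine_diagrams_def)

lemma bicolored_diagram_edgeE:
  assumes "(G, Black, White) \<in> bicolored_affine_diagrams" "e \<in># edges G"
    and V: "bij_betw V {..<r} Black" and W: "bij_betw W {..<s} White"
  obtains i j where "i < r" "j < s" "e = {V i, W j}"
proof -
  obtain x where "affine_graph G x"
    using assms(1) by (rule bicolored_affine_graphE)
  then interpret affine_graph G x .
  obtain u v where uv: "e = {u, v}" "u \<in> verts G" "v \<in> verts G"
    using edge_pairE[OF assms(2)] by metis
  have "edge_count G u v \<noteq> 0"
    using assms(2) by (auto simp: uv(1) edge_count_def)
  then have "\<not> (u \<in> Black \<and> v \<in> Black)" "\<not> (u \<in> White \<and> v \<in> White)"
    using assms(1) by (auto simp: bicolored_affine_diagrams_def)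
  moreover have "u \<in> Black \<union> White" "v \<in> Black \<union> White"
    using assms(1) uv(2,3) by (auto simp: bicolored_affine_diagrams_def)
  ultimately have "u \<in> Black \<and> v \<in> White \<or> v \<in> Black \<and> u \<in> White"
    by blast
  then obtain b w where bw: "b \<in> Black" "w \<in> White" "e = {b, w}"
    using uv(1) by (metis insert_commute)
  obtain i where "i < r" "b = V i"
    using bw(1) V by (metis bij_betw_imp_surj_on imageE lessThan_iff)
  moreover obtain j where "j < s" "w = W j"
    using bw(2) W by (metis bij_betw_imp_surj_on imageE lessThan_iff)
  ultimately show thesis using that bw(3) by blast
qed

lemma admissible_diagram_matrix:
  assumes D: "(G, Black, White) \<in> bicolored_affine_diagrams"
    and V: "bij_betw V {..<r} Black" and W: "bij_betw W {..<s} White"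
  shows "admissible (diagram_matrix G r s V W)"
proof -
  obtain x where "affine_graph G x"
    using D by (rule bicolored_affine_graphE)
  then interpret affine_graph G x .
  have BW: "Black \<union> White = verts G" "Black \<inter> White = {}"
    and black: "\<And>u v. u \<in> Black \<Longrightarrow> v \<in> Black \<Longrightarrow> edge_count G u v = 0"
    and white: "\<And>u v. u \<in> White \<Longrightarrow> v \<in> White \<Longrightarrow> edge_count G u v = 0"
    using D by (auto simp: bicolored_affine_diagrams_def)
  have Vr: "V i \<in> Black" if "i < r" for i using V that by (auto dest: bij_betwE)
  have Ws: "W j \<in> White" if "j < s" for j using W that by (auto dest: bij_betwE)
  have row: "(\<Sum>j<s. real (edge_count G u (W j)) * x (W j)) = 2 * x u" if u: "u \<in> Black" for u
  proof -
    have "(\<Sum>j<s. real (edge_count G u (W j)) * x (W j)) = (\<Sum>v\<in>White. real (edge_count G u v) * x v)"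
      by (rule sum.reindex_bij_betw[OF W])
    also have "\<dots> = (\<Sum>v\<in>verts G. real (edge_count G u v) * x v)"
      using BW finite_verts black[OF u] by (intro sum.mono_neutral_left) auto
    finally show ?thesis using label_sum[of u] BW u by auto
  qed
  have col: "(\<Sum>i<r. real (edge_count G (V i) v) * x (V i)) = 2 * x v" if v: "v \<in> White" for v
  proof -
    have "(\<Sum>i<r. real (edge_count G (V i) v) * x (V i)) = (\<Sum>u\<in>Black. real (edge_count G u v) * x u)"
      by (rule sum.reindex_bij_betw[OF V])
    also have "\<dots> = (\<Sum>u\<in>verts G. real (edge_count G v u) * x u)"
      using BW finite_verts white[OF v] unfolding edge_count_commute[of G _ v]
      by (intro sum.mono_neutral_left) auto
    finally show ?thesis using label_sum[of v] BW v by auto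
  qed
  have pos: "0 < x v" if "v \<in> Black \<union> White" for v
    using that label_pos BW by blast
  have "1 \<le> r \<and> 1 \<le> s"
  proof -
    have "1 \<le> s" if "u \<in> Black" for u
      using row[OF that] pos[of u] that by (cases s) auto
    moreover have "1 \<le> r" if "v \<in> White" for v
      using col[OF that] pos[of v] that by (cases r) auto
    moreover have "Black = {} \<longleftrightarrow> r = 0" "White = {} \<longleftrightarrow> s = 0"
      using V W by (auto simp: bij_betw_def)
    ultimately show ?thesis using verts_nonempty BW(1) by fastforce
  qed
  moreover have "\<not> decomposable (diagram_matrix G r s V W)"
  proof
    assume "decomposable (diagram_matrix G r s V W)"
    then obtain I I' J J' where I: "I \<union> I' = {..<r}" "I \<inter> I' = {}" and J: "J \<union> J' = {..<s}" "J \<inter> J' = {}"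
      and ne: "I \<noteq> {} \<or> J \<noteq> {}" "I' \<noteq> {} \<or> J' \<noteq> {}"
      and zero: "\<forall>(i, j) \<in> I \<times> J' \<union> I' \<times> J. diagram_matrix G r s V W $$ (i, j) = 0"
      unfolding decomposable_def dim_diagram_matrix by metis
    have Is: "i < r" if "i \<in> I \<union> I'" for i using that I by auto
    have Js: "j < s" if "j \<in> J \<union> J'" for j using that J by auto
    have sub: "V ` I \<subseteq> Black" "V ` I' \<subseteq> Black" "W ` J \<subseteq> White" "W ` J' \<subseteq> White"
      using Vr Ws Is Js by auto
    have IJ: "I \<subseteq> {..<r}" "I' \<subseteq> {..<r}" "J \<subseteq> {..<s}" "J' \<subseteq> {..<s}"
      using I(1) J(1) by auto
    have inj: "inj_on V {..<r}" "inj_on W {..<s}" using V W by (auto simp: bij_betw_def)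
    let ?S = "V ` I \<union> W ` J"
    have "?S = verts G"
    proof (rule connected)
      show "?S \<subseteq> verts G" using sub BW(1) by blast
      show "?S \<noteq> {}" using ne(1) by blast
      fix e assume e: "e \<in># edges G" "e \<inter> ?S \<noteq> {}"
      obtain i j where ij: "i < r" "j < s" "e = {V i, W j}"
        using bicolored_diagram_edgeE[OF D e(1) V W] .
      have "edge_count G (V i) (W j) \<noteq> 0"
        using e(1) ij(3) by (auto simp: edge_count_def)
      then have nz: "(i, j) \<notin> I \<times> J' \<union> I' \<times> J"
        using zero ij(1,2) by force
      have "i \<in> I \<or> j \<in> J"
      proof -
        have "V i \<notin> W ` J" "W j \<notin> V ` I"
          using Vr[OF ij(1)] Ws[OF ij(2)] sub(1,3) BW(2) by auto
        then have "V i \<in> V ` I \<or> W j \<in> W ` J" using e(2) ij(3) by auto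
        moreover have "V i \<in> V ` I \<longleftrightarrow> i \<in> I" "W j \<in> W ` J \<longleftrightarrow> j \<in> J"
          using inj_on_image_mem_iff[OF inj(1) _ IJ(1), of i] inj_on_image_mem_iff[OF inj(2) _ IJ(3), of j]
            ij(1,2) by simp_all
        ultimately show ?thesis by blast
      qed
      moreover have "i \<in> I \<or> i \<in> I'" "j \<in> J \<or> j \<in> J'"
        using ij(1,2) I(1) J(1) by auto
      ultimately show "e \<subseteq> ?S" using nz ij(3) by auto
    qed
    then have "V ` I' \<subseteq> ?S" "W ` J' \<subseteq> ?S" using sub(2,4) BW(1) by auto
    then have "V ` I' = V ` I' \<inter> ?S" "W ` J' = W ` J' \<inter> ?S" by (simp_all only: Int_absorb2)
    moreover have "V ` I' \<inter> W ` J = {}" "W ` J' \<inter> V ` I = {}" using sub BW(2) by blast+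
    moreover have "V ` I' \<inter> V ` I = {}" "W ` J' \<inter> W ` J = {}"
      using inj_on_image_Int[OF inj(1) IJ(2,1)] inj_on_image_Int[OF inj(2) IJ(4,3)] I(2) J(2)
      by (auto simp: Int_commute)
    ultimately have "V ` I' = {}" "W ` J' = {}" by (simp_all only: Int_Un_distrib Un_empty)
    then show False using ne(2) by blast
  qed
  moreover have "\<exists>m n. (\<forall>i<r. 0 < m i) \<and> (\<forall>j<s. 0 < n j) \<and>
        (\<forall>i<r. (\<Sum>j<s. real (diagram_matrix G r s V W $$ (i, j)) * n j) = 2 * m i) \<and>
        (\<forall>j<s. (\<Sum>i<r. real (diagram_matrix G r s V W $$ (i, j)) * m i) = 2 * n j)"
    using pos Vr Ws row col
    by (intro exI[of _ "\<lambda>i. x (V i)"] exI[of _ "\<lambda>j. x (W j)"]) simp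
  ultimately show ?thesis unfolding admissible_def by simp
qed

lemma diagram_iso_imp_perm_equiv:
  assumes iso: "((G, Black, White), (G', Black', White')) \<in> diagram_iso"
    and V: "bij_betw V {..<r} Black" and W: "bij_betw W {..<s} White"
    and V': "bij_betw V' {..<r'} Black'" and W': "bij_betw W' {..<s'} White'"
  shows "(diagram_matrix G r s V W, diagram_matrix G' r' s' V' W') \<in> perm_equiv"
proof -
  obtain f where D: "(G, Black, White) \<in> bicolored_affine_diagrams"
      "(G', Black', White') \<in> bicolored_affine_diagrams"
    and f: "graph_iso f G G'" "f ` Black = Black'" "f ` White = White'"
    using iso by (auto simp: diagram_iso_def)
  have sub: "Black \<subseteq> verts G" "White \<subseteq> verts G" and edges: "\<forall>e\<in>#edges G. e \<subseteq> verts G"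
    using D(1) affine_edges_subset by (auto simp: bicolored_affine_diagrams_def)
  have inj: "inj_on f (verts G)" using f(1) by (simp add: graph_iso_def bij_betw_def)
  have "bij_betw f Black Black'" "bij_betw f White White'"
    using inj_on_subset[OF inj] sub f(2,3) by (auto simp: bij_betw_def)
  then have fV: "bij_betw (f \<circ> V) {..<r} Black'" and fW: "bij_betw (f \<circ> W) {..<s} White'"
    using V W by (auto intro: bij_betw_trans)
  have rs: "r' = r" "s' = s"
    using bij_betw_same_card[OF fV] bij_betw_same_card[OF V'] bij_betw_same_card[OF fW]
      bij_betw_same_card[OF W'] by simp_all
  obtain p where p: "p permutes {..<r}" "\<forall>i<r. V' i = (f \<circ> V) (p i)"
    using permutes_of_bij_betw[OF fV V'[unfolded rs]] by blast
  obtain q where q: "q permutes {..<s}" "\<forall>j<s. W' j = (f \<circ> W) (q j)"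
    using permutes_of_bij_betw[OF fW W'[unfolded rs]] by blast
  have pq: "p i < r \<longleftrightarrow> i < r" "q j < s \<longleftrightarrow> j < s" for i j
    using permutes_in_image[OF p(1)] permutes_in_image[OF q(1)] by simp_all
  have "edge_count G' (V' i) (W' j) = edge_count G (V (p i)) (W (q j))" if "i < r" "j < s" for i j
  proof -
    have "V (p i) \<in> Black" "W (q j) \<in> White"
      using that bij_betwE[OF V] bij_betwE[OF W] by (simp_all add: pq)
    then have "V (p i) \<in> verts G" "W (q j) \<in> verts G" using sub by blast+
    then show ?thesis using graph_iso_edge_count[OF f(1) edges] p(2) q(2) that by simp
  qed
  then have "diagram_matrix G' r' s' V' W' =
      mat r s (\<lambda>(i, j). diagram_matrix G r s V W $$ (p i, q j))"
    by (intro eq_matI) (simp_all add: rs pq)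
  then show ?thesis
    using p(1) q(1) admissible_diagram_matrix[OF D(1) V W] admissible_diagram_matrix[OF D(2) V' W']
    by (auto simp: perm_equiv_def)
qed

lemma diagram_matrix_eq_imp_diagram_iso:
  assumes D: "(G, Black, White) \<in> bicolored_affine_diagrams"
    and D': "(G', Black', White') \<in> bicolored_affine_diagrams"
    and V: "bij_betw V {..<r} Black" and W: "bij_betw W {..<s} White"
    and V': "bij_betw V' {..<r} Black'" and W': "bij_betw W' {..<s} White'"
    and eq: "\<And>i j. i < r \<Longrightarrow> j < s \<Longrightarrow> edge_count G (V i) (W j) = edge_count G' (V' i) (W' j)"
  shows "((G, Black, White), (G', Black', White')) \<in> diagram_iso"
proof -
  define f where "f v = (if v \<in> Black then V' (inv_into {..<r} V v) else W' (inv_into {..<s} W v))" for v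
  have BW: "Black \<union> White = verts G" "Black \<inter> White = {}" "Black' \<union> White' = verts G'" "Black' \<inter> White' = {}"
    using D D' by (auto simp: bicolored_affine_diagrams_def)
  have fB: "bij_betw f Black Black'"
    using bij_betw_trans[OF bij_betw_inv_into[OF V] V'] by (rule bij_betw_cong[THEN iffD1, rotated]) (simp add: f_def)
  have fW: "bij_betw f White White'"
    using bij_betw_trans[OF bij_betw_inv_into[OF W] W']
    by (rule bij_betw_cong[THEN iffD1, rotated]) (use BW(2) in \<open>auto simp: f_def\<close>)
  have bij: "bij_betw f (verts G) (verts G')"
    using bij_betw_combine[OF fB fW BW(4)] BW by simp
  have fV: "f (V i) = V' i" if "i < r" for i
    using that V by (simp add: f_def bij_betw_inv_into_left bij_betwE)
  have fW': "f (W j) = W' j" if j: "j < s" for j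
  proof -
    have "W j \<in> White" using W j by (auto dest: bij_betwE)
    then have "W j \<notin> Black" using BW(2) by blast
    then show ?thesis using j W by (simp add: f_def bij_betw_inv_into_left)
  qed
  have edges: "\<forall>e\<in>#edges G. e \<subseteq> verts G"
    using D affine_edges_subset by (auto simp: bicolored_affine_diagrams_def)
  have "image_mset ((`) f) (edges G) = edges G'"
  proof (rule multiset_eqI)
    fix e
    show "count (image_mset ((`) f) (edges G)) e = count (edges G') e"
    proof (cases "\<exists>i<r. \<exists>j<s. e = {V' i, W' j}")
      case True
      then obtain i j where ij: "i < r" "j < s" "e = {V' i, W' j}" by blast
      have "{V i, W j} \<subseteq> verts G" using ij(1,2) V W BW(1) by (auto dest: bij_betwE)
      then have "count (image_mset ((`) f) (edges G)) (f ` {V i, W j}) = count (edges G) {V i, W j}"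
        using bij edges by (intro count_image_mset_image) (auto simp: bij_betw_def)
      then show ?thesis using eq[OF ij(1,2)] by (simp add: ij fV fW' edge_count_def)
    next
      case False
      have "e \<notin># edges G'" using False bicolored_diagram_edgeE[OF D' _ V' W'] by metis
      moreover have "e \<notin># image_mset ((`) f) (edges G)"
      proof
        assume "e \<in># image_mset ((`) f) (edges G)"
        then obtain d where d: "d \<in># edges G" "e = f ` d" by auto
        obtain i j where "i < r" "j < s" "d = {V i, W j}"
          using bicolored_diagram_edgeE[OF D d(1) V W] .
        with False d(2) show False by (auto simp: fV fW')
      qed
      ultimately show ?thesis by (simp only: count_eq_zero_iff[symmetric])
    qed
  qed
  then have "graph_iso f G G'" using bij by (simp add: graph_iso_def)
  then show ?thesis
    using D D' fB fW unfolding diagram_iso_def by (auto simp: bij_betw_def)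
qed

lemma perm_equiv_imp_diagram_iso:
  assumes D: "(G, Black, White) \<in> bicolored_affine_diagrams"
    and D': "(G', Black', White') \<in> bicolored_affine_diagrams"
    and V: "bij_betw V {..<r} Black" and W: "bij_betw W {..<s} White"
    and V': "bij_betw V' {..<r'} Black'" and W': "bij_betw W' {..<s'} White'"
    and equiv: "(diagram_matrix G r s V W, diagram_matrix G' r' s' V' W') \<in> perm_equiv"
  shows "((G, Black, White), (G', Black', White')) \<in> diagram_iso"
proof -
  obtain p q where p: "p permutes {..<r}" and q: "q permutes {..<s}"
    and eq: "diagram_matrix G' r' s' V' W' = mat r s (\<lambda>(i, j). diagram_matrix G r s V W $$ (p i, q j))"
    using equiv by (auto simp: perm_equiv_def)
  have rs: "r' = r" "s' = s"
    using arg_cong[OF eq, of dim_row] arg_cong[OF eq, of dim_col] by simp_all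
  have pq: "p i < r \<longleftrightarrow> i < r" "q j < s \<longleftrightarrow> j < s" for i j
    using permutes_in_image[OF p] permutes_in_image[OF q] by simp_all
  show ?thesis
  proof (rule diagram_matrix_eq_imp_diagram_iso[OF D D'])
    show "bij_betw (V \<circ> p) {..<r} Black" "bij_betw (W \<circ> q) {..<s} White"
      using permutes_imp_bij[OF p] permutes_imp_bij[OF q] V W by (auto intro: bij_betw_trans)
    show "bij_betw V' {..<r} Black'" "bij_betw W' {..<s} White'"
      using V' W' by (simp_all add: rs)
    show "edge_count G ((V \<circ> p) i) ((W \<circ> q) j) = edge_count G' (V' i) (W' j)" if "i < r" "j < s" for i j
      using arg_cong[OF eq, of "\<lambda>A. A $$ (i, j)"] that by (simp add: rs pq)
  qed
qed

lemma ex_diagram_of_admissible: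
  assumes "infinite (UNIV :: 'v set)" and A: "admissible A"
  obtains G :: "'v multigraph" and Black White V W where
    "(G, Black, White) \<in> bicolored_affine_diagrams"
    "bij_betw V {..<dim_row A} Black" "bij_betw W {..<dim_col A} White"
    "diagram_matrix G (dim_row A) (dim_col A) V W = A"
proof -
  define r s where "r = dim_row A" and "s = dim_col A"
  obtain m n where rs: "1 \<le> r" "1 \<le> s" and indec: "\<not> decomposable A"
    and m: "\<forall>i<r. 0 < m i" and n: "\<forall>j<s. 0 < n j"
    and row: "\<forall>i<r. (\<Sum>j<s. real (A $$ (i, j)) * n j) = 2 * m i"
    and col: "\<forall>j<s. (\<Sum>i<r. real (A $$ (i, j)) * m i) = 2 * n j"
    using A unfolding admissible_def r_def s_def by blast
  obtain T :: "'v set" where "finite T" "card T = r + s"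
    using infinite_arbitrarily_large[OF assms(1)] by blast
  then obtain V where V: "bij_betw V {0..<r + s} T"
    using ex_bij_betw_nat_finite by metis
  define W where "W j = V (r + j)" for j
  define Black White where "Black = V ` {..<r}" and "White = W ` {..<s}"
  define G where "G = Multigraph (Black \<union> White)
    (\<Sum>(i, j)\<in>{..<r} \<times> {..<s}. replicate_mset (A $$ (i, j)) {V i, W j})"
  have V_eq: "V i = V j \<longleftrightarrow> i = j" if "i < r + s" "j < r + s" for i j
    using V that by (auto simp: bij_betw_def inj_on_eq_iff)
  have VV: "V i = V j \<longleftrightarrow> i = j" if "i < r" "j < r" for i j using that by (simp add: V_eq)
  have WW: "W i = W j \<longleftrightarrow> i = j" if "i < s" "j < s" for i j using that by (simp add: W_def V_eq)
  have VW: "V i \<noteq> W j" if "i < r" "j < s" for i j using that by (simp add: W_def V_eq)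
  have bV: "bij_betw V {..<r} Black" and bW: "bij_betw W {..<s} White"
    by (auto simp: bij_betw_def inj_on_def Black_def White_def VV WW)
  have disj: "Black \<inter> White = {}"
    using VW by (auto simp: Black_def White_def)
  have mem: "e \<in># edges G \<longleftrightarrow> (\<exists>i<r. \<exists>j<s. e = {V i, W j} \<and> A $$ (i, j) \<noteq> 0)" for e
    by (auto simp: G_def set_mset_sum split: if_splits)
  have ec: "edge_count G (V i) (W j) = A $$ (i, j)" if ij: "i < r" "j < s" for i j
  proof -
    have "edge_count G (V i) (W j) =
        (\<Sum>k\<in>{..<r} \<times> {..<s}. if k = (i, j) then A $$ k else 0)"
      unfolding edge_count_def G_def multigraph.sel count_sum
    proof (intro sum.cong refl)
      fix k assume "k \<in> {..<r} \<times> {..<s}"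
      then obtain a b where k: "k = (a, b)" "a < r" "b < s" by auto
      have "{V i, W j} = {V a, W b} \<longleftrightarrow> a = i \<and> b = j"
        using k ij VW[of a j] VW[of i b] by (auto simp: doubleton_eq_iff VV WW)
      then show "count (case k of (i, j) \<Rightarrow> replicate_mset (A $$ (i, j)) {V i, W j}) {V i, W j} =
          (if k = (i, j) then A $$ k else 0)"
        by (simp add: k)
    qed
    then show ?thesis using ij by simp
  qed
  have black: "edge_count G u v = 0" if "u \<in> Black" "v \<in> Black" for u v
  proof -
    have "{u, v} \<notin># edges G"
      using that VW unfolding mem Black_def by (auto simp: doubleton_eq_iff)
    then show ?thesis by (simp add: edge_count_def count_eq_zero_iff)
  qed
  have white: "edge_count G u v = 0" if "u \<in> White" "v \<in> White" for u v
  proof -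
    have "{u, v} \<notin># edges G"
      using that VW unfolding mem White_def by (fastforce simp: doubleton_eq_iff)
    then show ?thesis by (simp add: edge_count_def count_eq_zero_iff)
  qed
  define x where "x v = (if v \<in> Black then m (inv_into {..<r} V v) else n (inv_into {..<s} W v))" for v
  have xV: "x (V i) = m i" if "i < r" for i
    using that bV by (simp add: x_def bij_betw_inv_into_left bij_betwE)
  have xW: "x (W j) = n j" if j: "j < s" for j
  proof -
    have "W j \<notin> Black" using j disj by (auto simp: White_def)
    then show ?thesis using j bW by (simp add: x_def bij_betw_inv_into_left)
  qed
  have verts: "verts G = Black \<union> White" by (simp add: G_def)
  have fin: "finite Black" "finite White" by (simp_all add: Black_def White_def)
  have sums: "(\<Sum>v\<in>verts G. h v) = (\<Sum>i<r. h (V i)) + (\<Sum>j<s. h (W j))" for h :: "'v \<Rightarrow> real"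
    unfolding verts using fin disj sum.reindex_bij_betw[OF bV, of h] sum.reindex_bij_betw[OF bW, of h]
    by (simp add: sum.union_disjoint)
  have "affine_graph G x"
  proof
    show "finite (verts G)" by (simp add: verts fin)
    show "verts G \<noteq> {}" using rs(1) by (auto simp: verts Black_def lessThan_empty_iff)
    show "e \<subseteq> verts G" if "e \<in># edges G" for e
      using that by (auto simp: mem verts Black_def White_def)
    show "card e = 2" if "e \<in># edges G" for e
      using that VW by (auto simp: mem)
    show "0 < x v" if "v \<in> verts G" for v
      using that m n xV xW by (auto simp: verts Black_def White_def)
    show "(\<Sum>v\<in>verts G. real (edge_count G u v) * x v) = 2 * x u" if u: "u \<in> verts G" for u
    proof (cases "u \<in> Black")
      case True
      then obtain i where i: "i < r" "u = V i" by (auto simp: Black_def)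
      then show ?thesis
        using row True unfolding sums by (simp add: ec xV xW black Black_def)
    next
      case False
      then obtain j where j: "j < s" "u = W j" using u by (auto simp: verts White_def)
      then show ?thesis
        using col unfolding sums by (simp add: edge_count_commute[of G "W j"] ec xV xW white White_def)
    qed
    show "S = verts G"
      if S: "S \<subseteq> verts G" "S \<noteq> {}" "\<And>e. e \<in># edges G \<Longrightarrow> e \<inter> S \<noteq> {} \<Longrightarrow> e \<subseteq> S" for S
    proof (rule ccontr)
      assume ne: "S \<noteq> verts G"
      let ?I = "{i. i < r \<and> V i \<in> S}" and ?I' = "{i. i < r \<and> V i \<notin> S}"
      let ?J = "{j. j < s \<and> W j \<in> S}" and ?J' = "{j. j < s \<and> W j \<notin> S}"
      have "?I \<union> ?I' = {..<r}" "?I \<inter> ?I' = {}" "?J \<union> ?J' = {..<s}" "?J \<inter> ?J' = {}" by auto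
      moreover have "?I \<noteq> {} \<or> ?J \<noteq> {}" "?I' \<noteq> {} \<or> ?J' \<noteq> {}"
        using S(1,2) ne by (auto simp: verts Black_def White_def)
      moreover have "\<forall>(i, j) \<in> ?I \<times> ?J' \<union> ?I' \<times> ?J. A $$ (i, j) = 0"
      proof (rule ccontr)
        assume "\<not> ?thesis"
        then obtain i j where ij: "i < r" "j < s" "A $$ (i, j) \<noteq> 0" "V i \<in> S \<longleftrightarrow> W j \<notin> S" by auto
        then have "{V i, W j} \<in># edges G" by (auto simp: mem)
        from S(3)[OF this] ij(4) show False by blast
      qed
      ultimately have "decomposable A"
        unfolding decomposable_def r_def[symmetric] s_def[symmetric] by blast
      then show False using indec by blast
    qed
  qed
  then have "simply_laced_affine_dynkin G" by (rule affine_graph.simply_laced)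
  then have "(G, Black, White) \<in> bicolored_affine_diagrams"
    using disj black white verts by (auto simp: bicolored_affine_diagrams_def)
  moreover have "diagram_matrix G r s V W = A"
    by (intro eq_matI) (simp_all add: ec r_def s_def)
  ultimately show thesis using that bV bW unfolding r_def s_def by blast
qed

lemma quotient_bij_betw:
  assumes E: "equiv X E" and F: "equiv Y F"
    and rel: "\<And>a b. R a b \<Longrightarrow> a \<in> X \<and> b \<in> Y"
    and left: "\<And>a. a \<in> X \<Longrightarrow> \<exists>b. R a b" and right: "\<And>b. b \<in> Y \<Longrightarrow> \<exists>a. R a b"
    and iff: "\<And>a b a' b'. R a b \<Longrightarrow> R a' b' \<Longrightarrow> (a, a') \<in> E \<longleftrightarrow> (b, b') \<in> F"
  shows "\<exists>\<Phi>. bij_betw \<Phi> (X // E) (Y // F) \<and> (\<forall>a b. R a b \<longrightarrow> \<Phi> (E `` {a}) = F `` {b})"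
proof -
  define \<Phi> where "\<Phi> C = (\<Union>a\<in>C. \<Union>b\<in>Collect (R a). F `` {b})" for C
  have \<Phi>: "\<Phi> (E `` {a}) = F `` {b}" if ab: "R a b" for a b
  proof
    show "\<Phi> (E `` {a}) \<subseteq> F `` {b}"
    proof
      fix c assume "c \<in> \<Phi> (E `` {a})"
      then obtain a' b' where "(a, a') \<in> E" "R a' b'" "(b', c) \<in> F"
        by (auto simp: \<Phi>_def)
      then show "c \<in> F `` {b}"
        using iff[OF ab] F by (meson Image_singleton_iff equivE transE)
    qed
    show "F `` {b} \<subseteq> \<Phi> (E `` {a})"
      using ab rel[OF ab] equiv_class_self[OF E] by (auto simp: \<Phi>_def)
  qed
  have "bij_betw \<Phi> (X // E) (Y // F)"
  proof (rule bij_betw_imageI)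
    show "inj_on \<Phi> (X // E)"
    proof (rule inj_onI)
      fix C C' assume C: "C \<in> X // E" "C' \<in> X // E" "\<Phi> C = \<Phi> C'"
      then obtain a a' where a: "a \<in> X" "a' \<in> X" "C = E `` {a}" "C' = E `` {a'}"
        by (auto elim!: quotientE)
      then obtain b b' where b: "R a b" "R a' b'" using left by blast
      then have "(b, b') \<in> F"
        using C(3) a rel \<Phi> eq_equiv_class[OF _ F] by metis
      then show "C = C'" using iff[OF b] a equiv_class_eq[OF E] by blast
    qed
    show "\<Phi> ` (X // E) = Y // F"
    proof
      show "\<Phi> ` (X // E) \<subseteq> Y // F"
        using left rel \<Phi> by (fastforce elim!: quotientE intro: quotientI)
      show "Y // F \<subseteq> \<Phi> ` (X // E)"
      proof
        fix C assume "C \<in> Y // F"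
        then obtain b where b: "b \<in> Y" "C = F `` {b}" by (auto elim: quotientE)
        obtain a where "R a b" using right[OF b(1)] by blast
        then show "C \<in> \<Phi> ` (X // E)"
          using \<Phi> rel b(2) quotientI by (metis image_eqI)
      qed
    qed
  qed
  with \<Phi> show ?thesis by blast
qed

theorem theorem4p1:
  assumes "infinite (UNIV :: 'v set)"
  shows "\<exists>\<Phi> :: 'v bicolored set \<Rightarrow> nat mat set.
     bij_betw \<Phi> (bicolored_affine_diagrams // diagram_iso) ({A. admissible A} // perm_equiv) \<and>
     (\<forall>(G, Black, White) \<in> bicolored_affine_diagrams. \<forall>r s V W.
        bij_betw V {..<r} Black \<longrightarrow> bij_betw W {..<s} White \<longrightarrow>
        admissible (diagram_matrix G r s V W) \<and>
        \<Phi> (diagram_iso `` {(G, Black, White)}) = perm_equiv `` {diagram_matrix G r s V W})"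
proof -
  define R :: "'v bicolored \<Rightarrow> nat mat \<Rightarrow> bool" where
    "R D A \<longleftrightarrow> D \<in> bicolored_affine_diagrams \<and> (\<exists>G Black White r s V W. D = (G, Black, White) \<and>
      bij_betw V {..<r} Black \<and> bij_betw W {..<s} White \<and> A = diagram_matrix G r s V W)" for D A
  have R: "R (G, Black, White) (diagram_matrix G r s V W)"
    if "(G, Black, White) \<in> bicolored_affine_diagrams" "bij_betw V {..<r} Black" "bij_betw W {..<s} White"
    for G :: "'v multigraph" and Black White r s V W
    using that unfolding R_def by blast
  have "\<exists>\<Phi>. bij_betw \<Phi> (bicolored_affine_diagrams // diagram_iso) ({A. admissible A} // perm_equiv) \<and>
      (\<forall>D A. R D A \<longrightarrow> \<Phi> (diagram_iso `` {D}) = perm_equiv `` {A})"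
  proof (rule quotient_bij_betw[OF equiv_diagram_iso equiv_perm_equiv])
    show "D \<in> bicolored_affine_diagrams \<and> A \<in> {A. admissible A}" if "R D A" for D A
      using that by (auto simp: R_def intro: admissible_diagram_matrix)
    show "\<exists>A. R D A" if D: "D \<in> bicolored_affine_diagrams" for D
    proof -
      obtain G Black White where D_eq: "D = (G, Black, White)" by (cases D)
      obtain x where "affine_graph G x"
        using D unfolding D_eq by (rule bicolored_affine_graphE)
      then have "finite (verts G)" by (rule affine_graph.finite_verts)
      moreover have "Black \<union> White = verts G"
        using D by (simp add: D_eq bicolored_affine_diagrams_def)
      ultimately have "finite Black" "finite White" by (metis finite_Un)+
      then obtain V W where "bij_betw V {..<card Black} Black" "bij_betw W {..<card White} White"
        using ex_bij_betw_nat_finite[of Black] ex_bij_betw_nat_finite[of White]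
        unfolding atLeast0LessThan by blast
      then show ?thesis using R D D_eq by blast
    qed
    show "\<exists>D. R D A" if "A \<in> {A. admissible A}" for A
    proof -
      have "admissible A" using that by simp
      then obtain G :: "'v multigraph" and Black White V W where
        "(G, Black, White) \<in> bicolored_affine_diagrams"
        "bij_betw V {..<dim_row A} Black" "bij_betw W {..<dim_col A} White"
        "diagram_matrix G (dim_row A) (dim_col A) V W = A"
        by (rule ex_diagram_of_admissible[OF assms])
      then show ?thesis using R by metis
    qed
    show "(D, D') \<in> diagram_iso \<longleftrightarrow> (A, A') \<in> perm_equiv" if D: "R D A" and D': "R D' A'" for D A D' A'
    proof -
      obtain G Black White r s V W where 1: "D = (G, Black, White)" "A = diagram_matrix G r s V W"
        "(G, Black, White) \<in> bicolored_affine_diagrams"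
        "bij_betw V {..<r} Black" "bij_betw W {..<s} White"
        using D unfolding R_def by blast
      obtain G' Black' White' r' s' V' W' where
        2: "D' = (G', Black', White')" "A' = diagram_matrix G' r' s' V' W'"
        "(G', Black', White') \<in> bicolored_affine_diagrams"
        "bij_betw V' {..<r'} Black'" "bij_betw W' {..<s'} White'"
        using D' unfolding R_def by blast
      show ?thesis
        unfolding 1(1,2) 2(1,2)
        using diagram_iso_imp_perm_equiv[OF _ 1(4,5) 2(4,5)]
          perm_equiv_imp_diagram_iso[OF 1(3) 2(3) 1(4,5) 2(4,5)] by (rule iffI)
    qed
  qed
  then obtain \<Phi> where bij: "bij_betw \<Phi> (bicolored_affine_diagrams // diagram_iso) ({A. admissible A} // perm_equiv)"
    and \<Phi>: "\<And>D A. R D A \<Longrightarrow> \<Phi> (diagram_iso `` {D}) = perm_equiv `` {A}"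
    by blast
  show ?thesis
  proof (intro exI[of _ \<Phi>] conjI bij ballI, clarify)
    fix G :: "'v multigraph" and Black White V W and r s :: nat
    assume D: "(G, Black, White) \<in> bicolored_affine_diagrams"
      "bij_betw V {..<r} Black" "bij_betw W {..<s} White"
    show "admissible (diagram_matrix G r s V W) \<and>
        \<Phi> (diagram_iso `` {(G, Black, White)}) = perm_equiv `` {diagram_matrix G r s V W}"
      using admissible_diagram_matrix[OF D] \<Phi>[OF R[OF D]] by blast
  qed
qed

end
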